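(* Let $\alpha$ be a set with an involution $\tau\colon\alpha\to\alpha$, and let $\beta\subset\alpha$ be a subset such that $\tau(\beta)=\beta$. The triple $(K_\beta(w),v_-,v_+)$, considered up to isomorphism, is a homotopy invariant of a nanoword $w$ over $\alpha$. That is, if nanowords $w,w'$ over $\alpha$ are homotopic, then there is an isomorphism of $\Lambda$-modules $K_\beta(w)\to K_\beta(w')$ carrying the input $v_-$ of $K_\beta(w)$ to the input of $K_\beta(w')$ and the output $v_+$ of $K_\beta(w)$ to the output of $K_\beta(w')$.
   Context: Fix a set $\alpha$ with an involution $\tau\colon\alpha\to\alpha$. An $\alpha$-alphabet is a set $\mathcal{A}$ with a map $\mathcal{A}\to\alpha$, $A\mapsto|A|$. A nanoword over $\alpha$ is a pair $(\mathcal{A},w)$, where $\mathcal{A}$ is a finite $\alpha$-alphabet and $w$ is a word (finite sequence) in letters of $\mathcal{A}$ in which every letter of $\mathcal{A}$ appears exactly twice. Two nanowords are isomorphic if there is a bijection of their alphabets commuting with the maps to $\alpha$ that sends the first word letterwise to the second. Homotopy of nanowords is the equivalence relation generated by isomorphisms and the following three moves and their inverses: (i) $(\mathcal{A},xAAy)\mapsto(\mathcal{A}-\{A\},xy)$, where $x,y$ are words on $\mathcal{A}-\{A\}$; (ii) $(\mathcal{A},xAByBAz)\mapsto(\mathcal{A}-\{A,B\},xyz)$ if $|A|=\tau(|B|)$, where $x,y,z$ are words on $\mathcal{A}-\{A,B\}$; (iii) $(\mathcal{A},xAByACzBCt)\mapsto(\mathcal{A},xBAyCAzCBt)$ if $|A|=|B|=|C|$,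 where $x,y,z,t$ are words on $\mathcal{A}-\{A,B,C\}$. Here $A$, $B$, $C$ are distinct letters of $\mathcal{A}$. Let $\Psi$ be the group with generators $\{a,a_\bullet\}_{a\in\alpha}$ and relations $aa_\bullet=a_\bullet a$, $a\tau(a)=1$, $a_\bullet\tau(a)_\bullet=1$ for all $a\in\alpha$, and let $\Lambda=\mathbb{Z}\Psi$ be its integral group ring. For a nanoword $(\mathcal{A},w)$ of length $n$, $K_\beta(w)$ is the left $\Lambda$-module $\Lambda^{n+1}/\psi(\Lambda^n)$, where $\Lambda^{n+1}$ is the free left module with basis $x_0,x_1,\dots,x_n$ and $\psi\colon\Lambda^n\to\Lambda^{n+1}$ is the homomorphism whose image is the left submodule generated by the following $n$ elements (the rows of an $n\times(n+1)$ matrix), two for each letter $A\in\mathcal{A}$. Let $a=|A|$ and let $i<j$ be the positions of the first and second occurrences of $A$ in $w$. If $a\in\beta$, the two elements are $a x_{i-1}-x_i$ and $(1-aa_\bullet)x_{i-1}+a_\bullet x_{j-1}-x_j$. If $a\in\alpha-\beta$, the two elements are $a x_{j-1}-x_j$ and $a_\bullet x_{i-1}-x_i+(1-aa_\bullet)x_{j-1}$. The input $v_-\in K_\beta(w)$ is the class of $x_0$ and the output $v_+\in K_\beta(w)$ is the class of $x_n$. *)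

theory Defs
  imports
    "HOL.Hull"
    "HOL-Algebra.Module"
    "HOL-Algebra.AbelCoset"
    "HOL-Algebra.Free_Abelian_Groups"
begin

section \<open>Nanowords and their homotopy\<close>

text \<open>
  The set \<open>\<alpha>\<close> and its involution \<open>\<tau>\<close> are explicit parameters. The letters of the alphabets come
  from an arbitrary type \<open>'l\<close>. Only the values of \<open>proj\<close> on \<open>letters\<close> matter.
\<close>

record ('l, 'a) nanoword =
  letters :: "'l set"
  proj :: "'l \<Rightarrow> 'a"
  word :: "'l list"

definition is_nanoword :: "'a set \<Rightarrow> ('l, 'a) nanoword \<Rightarrow> bool" where
  "is_nanoword \<alpha> W \<longleftrightarrow>
     finite (letters W) \<and> proj W \<in> letters W \<rightarrow> \<alpha> \<and> set (word W) \<subseteq> letters W \<and>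
     (\<forall>A\<in>letters W. count_list (word W) A = 2)"

definition nanoword_isomorphic :: "('l, 'a) nanoword \<Rightarrow> ('l, 'a) nanoword \<Rightarrow> bool" where
  "nanoword_isomorphic W W' \<longleftrightarrow>
     (\<exists>f. bij_betw f (letters W) (letters W') \<and>
          (\<forall>A\<in>letters W. proj W' (f A) = proj W A) \<and>
          word W' = map f (word W))"

inductive homotopy_step ::
    "'a set \<Rightarrow> ('a \<Rightarrow> 'a) \<Rightarrow> ('l, 'a) nanoword \<Rightarrow> ('l, 'a) nanoword \<Rightarrow> bool"
  for \<alpha> :: "'a set" and \<tau> :: "'a \<Rightarrow> 'a" where
  iso: "homotopy_step \<alpha> \<tau> W W'"
    if "is_nanoword \<alpha> W" "is_nanoword \<alpha> W'" "nanoword_isomorphic W W'"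
| move1: "homotopy_step \<alpha> \<tau>
            \<lparr>letters = L, proj = p, word = x @ [A, A] @ y\<rparr>
            \<lparr>letters = L - {A}, proj = p, word = x @ y\<rparr>"
    if "is_nanoword \<alpha> \<lparr>letters = L, proj = p, word = x @ [A, A] @ y\<rparr>"
       "A \<in> L" "set x \<union> set y \<subseteq> L - {A}"
| move2: "homotopy_step \<alpha> \<tau>
            \<lparr>letters = L, proj = p, word = x @ [A, B] @ y @ [B, A] @ z\<rparr>
            \<lparr>letters = L - {A, B}, proj = p, word = x @ y @ z\<rparr>"
    if "is_nanoword \<alpha> \<lparr>letters = L, proj = p, word = x @ [A, B] @ y @ [B, A] @ z\<rparr>"
       "A \<in> L" "B \<in> L" "A \<noteq> B" "set x \<union> set y \<union> set z \<subseteq> L - {A, B}"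
       "p A = \<tau> (p B)"
| move3: "homotopy_step \<alpha> \<tau>
            \<lparr>letters = L, proj = p, word = x @ [A, B] @ y @ [A, C] @ z @ [B, C] @ t\<rparr>
            \<lparr>letters = L, proj = p, word = x @ [B, A] @ y @ [C, A] @ z @ [C, B] @ t\<rparr>"
    if "is_nanoword \<alpha> \<lparr>letters = L, proj = p, word = x @ [A, B] @ y @ [A, C] @ z @ [B, C] @ t\<rparr>"
       "A \<in> L" "B \<in> L" "C \<in> L" "distinct [A, B, C]"
       "set x \<union> set y \<union> set z \<union> set t \<subseteq> L - {A, B, C}"
       "p A = p B" "p B = p C"

definition homotopic ::
    "'a set \<Rightarrow> ('a \<Rightarrow> 'a) \<Rightarrow> ('l, 'a) nanoword \<Rightarrow> ('l, 'a) nanoword \<Rightarrow> bool" where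
  "homotopic \<alpha> \<tau> = equivclp (homotopy_step \<alpha> \<tau>)"


section \<open>Groups given by generators and relations\<close>

text \<open>
  Group words are lists of signed generators; \<open>(x, True)\<close> stands for the generator \<open>x\<close> and
  \<open>(x, False)\<close> for its formal inverse. A pair \<open>(l, r)\<close> of group words encodes the relation \<open>l = r\<close>.
\<close>

type_synonym 'x gword = "('x \<times> bool) list"

definition gwords :: "'x set \<Rightarrow> 'x gword set" where
  "gwords X = {u. fst ` set u \<subseteq> X}"

inductive pres_step :: "'x set \<Rightarrow> ('x gword \<times> 'x gword) set \<Rightarrow> 'x gword \<Rightarrow> 'x gword \<Rightarrow> bool"
  for X :: "'x set" and Q :: "('x gword \<times> 'x gword) set" where
  cancel: "pres_step X Q (u @ [(x, b), (x, \<not> b)] @ v) (u @ v)"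
    if "u \<in> gwords X" "v \<in> gwords X" "x \<in> X"
| rel: "pres_step X Q (u @ l @ v) (u @ r @ v)"
    if "u \<in> gwords X" "v \<in> gwords X" "(l, r) \<in> Q"

definition pres_rel :: "'x set \<Rightarrow> ('x gword \<times> 'x gword) set \<Rightarrow> ('x gword \<times> 'x gword) set" where
  "pres_rel X Q = {(u, v). u \<in> gwords X \<and> v \<in> gwords X \<and> equivclp (pres_step X Q) u v}"

definition presented_group ::
    "'x set \<Rightarrow> ('x gword \<times> 'x gword) set \<Rightarrow> 'x gword set monoid" where
  "presented_group X Q =
     \<lparr>carrier = gwords X // pres_rel X Q,
      monoid.mult = (\<lambda>C D. \<Union>u\<in>C. \<Union>v\<in>D. pres_rel X Q `` {u @ v}),
      one = pres_rel X Q `` {[]}\<rparr>"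

lemma equiv_pres_rel: "equiv (gwords X) (pres_rel X Q)"
proof (rule equivI)
  show "refl_on (gwords X) (pres_rel X Q)"
    by (auto simp: refl_on_def pres_rel_def)
  show "pres_rel X Q \<subseteq> gwords X \<times> gwords X"
    by (auto simp: pres_rel_def)
  show "sym (pres_rel X Q)"
    by (auto simp: sym_def pres_rel_def intro: equivclp_sym)
  show "trans (pres_rel X Q)"
    by (auto simp: trans_def pres_rel_def intro: equivclp_trans)
qed

lemma gwords_append [simp]: "u @ v \<in> gwords X \<longleftrightarrow> u \<in> gwords X \<and> v \<in> gwords X"
  by (auto simp: gwords_def)

lemma gwords_Nil [simp]: "[] \<in> gwords X"
  by (simp add: gwords_def)

lemma gwords_Cons [simp]: "(x, b) # v \<in> gwords X \<longleftrightarrow> x \<in> X \<and> v \<in> gwords X"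
  by (auto simp: gwords_def)

lemma pres_step_context:
  assumes "pres_step X Q u v" "s \<in> gwords X" "t \<in> gwords X"
  shows "pres_step X Q (s @ u @ t) (s @ v @ t)"
  using assms(1)
proof cases
  case (cancel u' v' x b)
  then show ?thesis
    using pres_step.cancel[of "s @ u'" X "v' @ t" x Q b] assms by simp
next
  case (rel u' v' l r)
  then show ?thesis
    using pres_step.rel[of "s @ u'" X "v' @ t" l r Q] assms by simp
qed

lemma equivclp_pres_step_context:
  assumes "equivclp (pres_step X Q) u v" "s \<in> gwords X" "t \<in> gwords X"
  shows "equivclp (pres_step X Q) (s @ u @ t) (s @ v @ t)"
  using assms(1)
proof (induction rule: equivclp_induct)
  case base
  then show ?case by simp
next
  case (step y z)
  then show ?case
    using pres_step_context[OF _ assms(2,3)]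
    by (meson equivclp_trans equivclp_sym r_into_equivclp)
qed

lemma pres_rel_append:
  assumes "(u, u') \<in> pres_rel X Q" "(v, v') \<in> pres_rel X Q"
  shows "(u @ v, u' @ v') \<in> pres_rel X Q"
proof -
  have w: "u \<in> gwords X" "u' \<in> gwords X" "v \<in> gwords X" "v' \<in> gwords X"
    using assms by (auto simp: pres_rel_def)
  have "equivclp (pres_step X Q) (u @ v) (u' @ v)"
    using equivclp_pres_step_context[of X Q u u' "[]" v] assms w by (simp add: pres_rel_def)
  moreover have "equivclp (pres_step X Q) (u' @ v) (u' @ v')"
    using equivclp_pres_step_context[of X Q v v' u' "[]"] assms w by (simp add: pres_rel_def)
  ultimately show ?thesis
    using w by (auto simp: pres_rel_def intro: equivclp_trans)
qed

lemma presented_group_mult: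
  assumes "u \<in> gwords X" "v \<in> gwords X"
  shows "(pres_rel X Q `` {u}) \<otimes>\<^bsub>presented_group X Q\<^esub> (pres_rel X Q `` {v})
         = pres_rel X Q `` {u @ v}"
proof -
  have "congruent2 (pres_rel X Q) (pres_rel X Q) (\<lambda>u v. pres_rel X Q `` {u @ v})"
    by (auto simp: congruent2_def intro!: equiv_class_eq[OF equiv_pres_rel] pres_rel_append)
  then show ?thesis
    by (simp add: presented_group_def UN_equiv_class2[OF equiv_pres_rel equiv_pres_rel] assms)
qed

lemma presented_group_is_group: "group (presented_group X Q)"
proof (rule groupI)
  let ?G = "presented_group X Q" and ?c = "\<lambda>u. pres_rel X Q `` {u}"
  have cE: "\<exists>u\<in>gwords X. C = ?c u" if "C \<in> carrier ?G" for C
    using that by (auto simp: presented_group_def elim!: quotientE)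
  have cI: "?c u \<in> carrier ?G" if "u \<in> gwords X" for u
    using that by (simp add: presented_group_def quotientI)
  have one: "\<one>\<^bsub>?G\<^esub> = ?c []"
    by (simp add: presented_group_def)
  show "C \<otimes>\<^bsub>?G\<^esub> D \<in> carrier ?G" if "C \<in> carrier ?G" "D \<in> carrier ?G" for C D
    using cE[OF that(1)] cE[OF that(2)] by (auto simp: presented_group_mult intro!: cI)
  show "\<one>\<^bsub>?G\<^esub> \<in> carrier ?G"
    by (simp add: one cI)
  show "C \<otimes>\<^bsub>?G\<^esub> D \<otimes>\<^bsub>?G\<^esub> E = C \<otimes>\<^bsub>?G\<^esub> (D \<otimes>\<^bsub>?G\<^esub> E)"
    if "C \<in> carrier ?G" "D \<in> carrier ?G" "E \<in> carrier ?G" for C D E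
    using cE[OF that(1)] cE[OF that(2)] cE[OF that(3)] by (auto simp: presented_group_mult)
  show "\<one>\<^bsub>?G\<^esub> \<otimes>\<^bsub>?G\<^esub> C = C" if "C \<in> carrier ?G" for C
    using cE[OF that] by (auto simp: presented_group_mult one)
  have inv: "\<exists>v\<in>gwords X. equivclp (pres_step X Q) (v @ u) []" if "u \<in> gwords X" for u
    using that
  proof (induction u rule: rev_induct)
    case Nil
    then show ?case by (intro bexI[of _ "[]"]) auto
  next
    case (snoc xb u)
    obtain x b where xb: "xb = (x, b)" by force
    with snoc obtain v where v: "v \<in> gwords X" "equivclp (pres_step X Q) (v @ u) []" "x \<in> X"
      by auto
    have "equivclp (pres_step X Q) ([(x, \<not> b)] @ (v @ u) @ [(x, b)]) ([(x, \<not> b)] @ [] @ [(x, b)])"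
      by (rule equivclp_pres_step_context) (use v in auto)
    moreover have "pres_step X Q ([] @ [(x, \<not> b), (x, \<not> \<not> b)] @ []) ([] @ [])"
      by (rule pres_step.cancel) (use v in auto)
    ultimately have "equivclp (pres_step X Q) (((x, \<not> b) # v) @ u @ [(x, b)]) []"
      by (auto intro: equivclp_trans)
    then show ?case
      using v xb by (intro bexI[of _ "(x, \<not> b) # v"]) auto
  qed
  show "\<exists>D\<in>carrier ?G. D \<otimes>\<^bsub>?G\<^esub> C = \<one>\<^bsub>?G\<^esub>" if "C \<in> carrier ?G" for C
  proof -
    obtain u where u: "u \<in> gwords X" "C = ?c u"
      using cE[OF \<open>C \<in> carrier ?G\<close>] by auto
    obtain v where v: "v \<in> gwords X" "equivclp (pres_step X Q) (v @ u) []"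
      using inv u by auto
    have "?c (v @ u) = ?c []"
      by (rule equiv_class_eq[OF equiv_pres_rel]) (use u v in \<open>auto simp: pres_rel_def\<close>)
    then show ?thesis
      using u v by (intro bexI[of _ "?c v"]) (auto simp: presented_group_mult one cI)
  qed
qed


section \<open>Integral group rings\<close>

text \<open>
  The underlying additive group is that of \<^const>\<open>free_Abelian_group\<close>; the product is the bilinear
  extension of the group multiplication.
\<close>

definition group_ring :: "('g, 'm) monoid_scheme \<Rightarrow> ('g \<Rightarrow>\<^sub>0 int) ring" where
  "group_ring G =
     \<lparr>carrier = {c. Poly_Mapping.keys c \<subseteq> carrier G},
      monoid.mult = (\<lambda>c d. frag_extend (\<lambda>g. frag_extend (\<lambda>h. frag_of (g \<otimes>\<^bsub>G\<^esub> h)) d) c),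
      one = frag_of \<one>\<^bsub>G\<^esub>,
      ring.zero = 0,
      ring.add = (+)\<rparr>"

lemma group_ring_is_ring:
  assumes "group G"
  shows "ring (group_ring G)"
proof -
  interpret group G by fact
  let ?R = "group_ring G"
  have carr: "c \<in> carrier ?R \<longleftrightarrow> Poly_Mapping.keys c \<subseteq> carrier G" for c
    by (simp add: group_ring_def)
  have add: "c \<oplus>\<^bsub>?R\<^esub> d = c + d" and zero: "\<zero>\<^bsub>?R\<^esub> = 0"
    and one: "\<one>\<^bsub>?R\<^esub> = frag_of \<one>\<^bsub>G\<^esub>" for c d
    by (simp_all add: group_ring_def)
  let ?m = "\<lambda>c d. c \<otimes>\<^bsub>?R\<^esub> d"
  have m_def: "?m c d = frag_extend (\<lambda>g. frag_extend (\<lambda>h. frag_of (g \<otimes>\<^bsub>G\<^esub> h)) d) c" for c d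
    by (simp add: group_ring_def)
  have frag_add: "frag_extend (\<lambda>g. f g + f' g) c = frag_extend f c + frag_extend f' c"
    for f f' :: "'a \<Rightarrow> ('a \<Rightarrow>\<^sub>0 int)" and c
    by (simp add: frag_extend_def frag_cmul_distrib2 sum.distrib)
  have frag_diff: "frag_extend (\<lambda>g. f g - f' g) c = frag_extend f c - frag_extend f' c"
    for f f' :: "'a \<Rightarrow> ('a \<Rightarrow>\<^sub>0 int)" and c
    using frag_add[of "\<lambda>g. f g - f' g" f' c] by (simp add: algebra_simps)
  have l1: "?m (c - c') d = ?m c d - ?m c' d" and l2: "?m (c + c') d = ?m c d + ?m c' d"
    and l3: "?m 0 d = 0" for c c' d
    by (simp_all add: m_def frag_extend_diff frag_extend_add)
  have r1: "?m c (d - d') = ?m c d - ?m c d'" and r2: "?m c (d + d') = ?m c d + ?m c d'"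
    and r3: "?m c 0 = 0" for c d d'
    by (simp_all add: m_def frag_extend_diff frag_extend_add frag_diff frag_add frag_extend_eq_0)
  have of_of: "?m (frag_of g) (frag_of h) = frag_of (g \<otimes>\<^bsub>G\<^esub> h)" for g h
    by (simp add: m_def)
  have closed: "?m c d \<in> carrier ?R" if "c \<in> carrier ?R" "d \<in> carrier ?R" for c d
    using that unfolding carr m_def
    by (intro order_trans[OF keys_frag_extend] UN_least) (auto simp: keys_frag_of subset_iff)
  have assoc: "?m (?m c d) e = ?m c (?m d e)"
    if "c \<in> carrier ?R" "d \<in> carrier ?R" "e \<in> carrier ?R" for c d e
  proof -
    have a1: "?m (?m (frag_of g) (frag_of h)) e = ?m (frag_of g) (?m (frag_of h) e)"
      if "g \<in> carrier G" "h \<in> carrier G" for g h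
      using \<open>e \<in> carrier ?R\<close>[unfolded carr]
      by (induction e rule: frag_induction) (simp_all add: r1 r3 of_of m_assoc that)
    have a2: "?m (?m (frag_of g) d) e = ?m (frag_of g) (?m d e)" if "g \<in> carrier G" for g
      using \<open>d \<in> carrier ?R\<close>[unfolded carr]
      by (induction d rule: frag_induction) (simp_all add: l1 r1 l3 r3 a1 that)
    show ?thesis
      using \<open>c \<in> carrier ?R\<close>[unfolded carr]
      by (induction c rule: frag_induction) (simp_all add: l1 l3 a2)
  qed
  have one_l: "?m \<one>\<^bsub>?R\<^esub> c = c" if "c \<in> carrier ?R" for c
    using that[unfolded carr] 
    by (induction c rule: frag_induction) (simp_all add: one r1 r3 of_of)
  have one_r: "?m c \<one>\<^bsub>?R\<^esub> = c" if "c \<in> carrier ?R" for c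
    using that[unfolded carr] 
    by (induction c rule: frag_induction) (simp_all add: one l1 l3 of_of)
  show ?thesis
  proof (rule ringI)
    show "abelian_group ?R"
    proof (rule abelian_groupI)
      show "\<exists>d\<in>carrier ?R. d \<oplus>\<^bsub>?R\<^esub> c = \<zero>\<^bsub>?R\<^esub>" if "c \<in> carrier ?R" for c
        using that by (intro bexI[of _ "- c"]) (auto simp: carr add zero)
    qed (auto simp: carr add zero algebra_simps dest: subsetD[OF keys_add])
    show "monoid ?R"
      by (rule monoidI) (auto simp: closed assoc one_l one_r, auto simp: carr one keys_frag_of)
  qed (auto simp: add l2 r2)
qed


section \<open>Left modules over a possibly noncommutative ring\<close>

text \<open>
  The locale \<^locale>\<open>module\<close> requires a commutative ring of scalars, so left modules are introduced here,
  on the same record type. The multiplicative fields of a module record are irrelevant.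
\<close>

locale left_module = R?: ring R + M?: abelian_group M
  for R :: "('r, 's) ring_scheme" (structure) and M :: "('r, 'm, 't) module_scheme" (structure) +
  assumes smult_closed [simp, intro]:
      "\<lbrakk>a \<in> carrier R; x \<in> carrier M\<rbrakk> \<Longrightarrow> a \<odot>\<^bsub>M\<^esub> x \<in> carrier M"
    and smult_l_distr:
      "\<lbrakk>a \<in> carrier R; b \<in> carrier R; x \<in> carrier M\<rbrakk> \<Longrightarrow>
       (a \<oplus>\<^bsub>R\<^esub> b) \<odot>\<^bsub>M\<^esub> x = a \<odot>\<^bsub>M\<^esub> x \<oplus>\<^bsub>M\<^esub> b \<odot>\<^bsub>M\<^esub> x"
    and smult_r_distr:
      "\<lbrakk>a \<in> carrier R; x \<in> carrier M; y \<in> carrier M\<rbrakk> \<Longrightarrow>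
       a \<odot>\<^bsub>M\<^esub> (x \<oplus>\<^bsub>M\<^esub> y) = a \<odot>\<^bsub>M\<^esub> x \<oplus>\<^bsub>M\<^esub> a \<odot>\<^bsub>M\<^esub> y"
    and smult_assoc1:
      "\<lbrakk>a \<in> carrier R; b \<in> carrier R; x \<in> carrier M\<rbrakk> \<Longrightarrow>
       (a \<otimes>\<^bsub>R\<^esub> b) \<odot>\<^bsub>M\<^esub> x = a \<odot>\<^bsub>M\<^esub> (b \<odot>\<^bsub>M\<^esub> x)"
    and smult_one [simp]:
      "x \<in> carrier M \<Longrightarrow> \<one>\<^bsub>R\<^esub> \<odot>\<^bsub>M\<^esub> x = x"

definition module_iso ::
    "('r, 's) ring_scheme \<Rightarrow> ('r, 'm, 't) module_scheme \<Rightarrow> ('r, 'k, 'u) module_scheme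
     \<Rightarrow> ('m \<Rightarrow> 'k) set" where
  "module_iso R M N =
     {h \<in> iso (add_monoid M) (add_monoid N).
        \<forall>r\<in>carrier R. \<forall>x\<in>carrier M. h (r \<odot>\<^bsub>M\<^esub> x) = r \<odot>\<^bsub>N\<^esub> h x}"

definition free_module :: "('r, 's) ring_scheme \<Rightarrow> 'i set \<Rightarrow> ('r, 'i \<Rightarrow> 'r) module" where
  "free_module R I =
     \<lparr>carrier = I \<rightarrow>\<^sub>E carrier R,
      monoid.mult = undefined,
      monoid.one = undefined,
      ring.zero = (\<lambda>i\<in>I. \<zero>\<^bsub>R\<^esub>),
      ring.add = (\<lambda>x y. \<lambda>i\<in>I. x i \<oplus>\<^bsub>R\<^esub> y i),
      smult = (\<lambda>r x. \<lambda>i\<in>I. r \<otimes>\<^bsub>R\<^esub> x i)\<rparr>"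
  \<comment> \<open>For finite \<open>I\<close>; for infinite \<open>I\<close> this is the direct product.\<close>

definition basis_vec :: "('r, 's) ring_scheme \<Rightarrow> 'i set \<Rightarrow> 'i \<Rightarrow> 'i \<Rightarrow> 'r" where
  "basis_vec R I k = (\<lambda>i\<in>I. if i = k then \<one>\<^bsub>R\<^esub> else \<zero>\<^bsub>R\<^esub>)"

definition span_submodule ::
    "('r, 's) ring_scheme \<Rightarrow> ('r, 'm, 't) module_scheme \<Rightarrow> 'm set \<Rightarrow> 'm set" where
  "span_submodule R M S = (\<lambda>N. submodule N R M) hull S"

definition quotient_module ::
    "('r, 's) ring_scheme \<Rightarrow> ('r, 'm, 't) module_scheme \<Rightarrow> 'm set \<Rightarrow> ('r, 'm set) module" where
  "quotient_module R M N =
     \<lparr>carrier = a_rcosets\<^bsub>M\<^esub> N,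
      monoid.mult = undefined,
      monoid.one = undefined,
      ring.zero = N,
      ring.add = (<+>\<^bsub>M\<^esub>),
      smult = (\<lambda>r C. \<Union>v\<in>C. N +>\<^bsub>M\<^esub> (r \<odot>\<^bsub>M\<^esub> v))\<rparr>"

lemma free_module_left_module:
  assumes "ring R"
  shows "left_module R (free_module R I)"
proof -
  interpret ring R by fact
  have "abelian_group (free_module R I)"
  proof (rule abelian_groupI)
    show "\<exists>y\<in>carrier (free_module R I). y \<oplus>\<^bsub>free_module R I\<^esub> x = \<zero>\<^bsub>free_module R I\<^esub>"
      if "x \<in> carrier (free_module R I)" for x
      using that
      by (intro bexI[of _ "\<lambda>i\<in>I. \<ominus>\<^bsub>R\<^esub> x i"])
         (auto simp: free_module_def PiE_iff intro!: restrict_ext l_neg)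
  qed (auto simp: free_module_def PiE_iff extensional_def a_ac fun_eq_iff)
  then show ?thesis
    by (intro left_module.intro left_module_axioms.intro assms)
       (auto simp: free_module_def PiE_iff extensional_def l_distr r_distr m_assoc fun_eq_iff)
qed

lemma basis_vec_carrier:
  assumes "ring R"
  shows "basis_vec R I k \<in> carrier (free_module R I)"
proof -
  interpret ring R by fact
  show ?thesis by (auto simp: basis_vec_def free_module_def)
qed

context left_module
begin

lemma carrier_submodule: "submodule (carrier M) R M"
  by (intro submodule.intro submodule_axioms.intro M.add.subgroup_self) auto

lemma span_submodule_is_submodule:
  assumes "S \<subseteq> carrier M"
  shows "submodule (span_submodule R M S) R M"
proof -
  have Inter: "submodule (\<Inter>F) R M" if "F \<noteq> {}" "\<And>N. N \<in> F \<Longrightarrow> submodule N R M" for F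
  proof (intro submodule.intro submodule_axioms.intro)
    show "subgroup (\<Inter>F) (add_monoid M)"
      using that by (intro M.add.subgroups_Inter) (auto dest: submodule.axioms(1))
    show "a \<odot>\<^bsub>M\<^esub> x \<in> \<Inter>F" if "a \<in> carrier R" "x \<in> \<Inter>F" for a x
      using that \<open>\<And>N. N \<in> F \<Longrightarrow> submodule N R M\<close> by (auto intro: submodule.smult_closed)
  qed
  have "submodule (\<Inter>{N. submodule N R M \<and> S \<subseteq> N}) R M"
  proof (rule Inter)
    have "carrier M \<in> {N. submodule N R M \<and> S \<subseteq> N}"
      using carrier_submodule assms by simp
    then show "{N. submodule N R M \<and> S \<subseteq> N} \<noteq> {}"
      by (metis empty_iff)
  qed simp
  then show ?thesis
    by (simp only: span_submodule_def hull_def)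
qed

lemma quotient_smult:
  assumes "submodule N R M" "r \<in> carrier R" "v \<in> carrier M"
  shows "r \<odot>\<^bsub>quotient_module R M N\<^esub> (N +>\<^bsub>M\<^esub> v) = N +>\<^bsub>M\<^esub> (r \<odot>\<^bsub>M\<^esub> v)"
proof -
  interpret N: submodule N R M by fact
  have sub: "N \<subseteq> carrier M" using N.subset by simp
  have sg: "subgroup N (add_monoid M)" by (rule N.subgroup_axioms)
  have *: "N +>\<^bsub>M\<^esub> (r \<odot>\<^bsub>M\<^esub> (n \<oplus>\<^bsub>M\<^esub> v)) = N +>\<^bsub>M\<^esub> (r \<odot>\<^bsub>M\<^esub> v)" if "n \<in> N" for n
  proof -
    have "r \<odot>\<^bsub>M\<^esub> n \<in> N" using that assms by (simp add: N.smult_closed)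
    moreover have "r \<odot>\<^bsub>M\<^esub> (n \<oplus>\<^bsub>M\<^esub> v) = r \<odot>\<^bsub>M\<^esub> n \<oplus>\<^bsub>M\<^esub> r \<odot>\<^bsub>M\<^esub> v"
      using that assms sub by (intro smult_r_distr) auto
    ultimately have "r \<odot>\<^bsub>M\<^esub> (n \<oplus>\<^bsub>M\<^esub> v) \<in> N +>\<^bsub>M\<^esub> (r \<odot>\<^bsub>M\<^esub> v)"
      unfolding a_r_coset_def' by blast
    then show ?thesis
      using M.a_repr_independence[of _ N] sg assms
      by (metis M.add.repr_independence smult_closed)
  qed
  have ne: "\<zero>\<^bsub>M\<^esub> \<in> N" using N.one_closed by simp
  have "(\<Union>w\<in>N +>\<^bsub>M\<^esub> v. N +>\<^bsub>M\<^esub> (r \<odot>\<^bsub>M\<^esub> w)) = (\<Union>n\<in>N. N +>\<^bsub>M\<^esub> (r \<odot>\<^bsub>M\<^esub> (n \<oplus>\<^bsub>M\<^esub> v)))"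
    by (auto simp: a_r_coset_def')
  also have "\<dots> = N +>\<^bsub>M\<^esub> (r \<odot>\<^bsub>M\<^esub> v)"
    using * ne by auto
  finally show ?thesis
    by (simp add: quotient_module_def)
qed

lemma quotient_add:
  assumes "submodule N R M" "v \<in> carrier M" "w \<in> carrier M"
  shows "(N +>\<^bsub>M\<^esub> v) \<oplus>\<^bsub>quotient_module R M N\<^esub> (N +>\<^bsub>M\<^esub> w) = N +>\<^bsub>M\<^esub> (v \<oplus>\<^bsub>M\<^esub> w)"
proof -
  have "abelian_subgroup N M"
    by (rule abelian_subgroupI3[OF additive_subgroup.intro])
       (use assms in \<open>auto intro: submodule.axioms(1) M.abelian_group_axioms\<close>)
  then show ?thesis
    using assms abelian_subgroup.a_rcos_sum[of N M v w] by (simp add: quotient_module_def)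
qed

lemma quotient_left_module:
  assumes "submodule N R M"
  shows "left_module R (quotient_module R M N)"
proof -
  let ?Q = "quotient_module R M N"
  interpret N: submodule N R M by fact
  have carr: "carrier ?Q = (\<lambda>v. N +>\<^bsub>M\<^esub> v) ` carrier M"
    by (auto simp: quotient_module_def A_RCOSETS_def')
  have sub: "N \<subseteq> carrier M" using N.subset by simp
  have zero: "\<zero>\<^bsub>?Q\<^esub> = N +>\<^bsub>M\<^esub> \<zero>\<^bsub>M\<^esub>"
    using M.a_coset_add_zero[OF sub] by (simp add: quotient_module_def)
  note qa = quotient_add[OF assms] and qs = quotient_smult[OF assms]
  have ci: "N +>\<^bsub>M\<^esub> v \<in> carrier ?Q" if "v \<in> carrier M" for v
    using that unfolding carr by (rule imageI)
  have cE: thesis if "C \<in> carrier ?Q" "\<And>v. v \<in> carrier M \<Longrightarrow> C = N +>\<^bsub>M\<^esub> v \<Longrightarrow> thesis" for C thesis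
    using that unfolding carr by blast
  have "abelian_group ?Q"
  proof (rule abelian_groupI)
    show "\<zero>\<^bsub>?Q\<^esub> \<in> carrier ?Q"
      unfolding zero by (rule ci) simp
    show "\<zero>\<^bsub>?Q\<^esub> \<oplus>\<^bsub>?Q\<^esub> C = C" if "C \<in> carrier ?Q" for C
      using that by (elim cE) (simp add: zero qa)
    show "\<exists>D\<in>carrier ?Q. D \<oplus>\<^bsub>?Q\<^esub> C = \<zero>\<^bsub>?Q\<^esub>" if "C \<in> carrier ?Q" for C
    proof -
      obtain v where v: "v \<in> carrier M" "C = N +>\<^bsub>M\<^esub> v" using \<open>C \<in> carrier ?Q\<close> by (rule cE)
      then have "(N +>\<^bsub>M\<^esub> (\<ominus>\<^bsub>M\<^esub> v)) \<oplus>\<^bsub>?Q\<^esub> C = \<zero>\<^bsub>?Q\<^esub>"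
        by (simp add: qa zero M.l_neg)
      moreover have "N +>\<^bsub>M\<^esub> (\<ominus>\<^bsub>M\<^esub> v) \<in> carrier ?Q"
        using v by (intro ci) simp
      ultimately show ?thesis ..
    qed
  next
    fix C D E assume "C \<in> carrier ?Q" "D \<in> carrier ?Q" "E \<in> carrier ?Q"
    then show "C \<oplus>\<^bsub>?Q\<^esub> D \<oplus>\<^bsub>?Q\<^esub> E = C \<oplus>\<^bsub>?Q\<^esub> (D \<oplus>\<^bsub>?Q\<^esub> E)"
      by (elim cE) (simp add: qa M.a_assoc)
  next
    fix C D assume CD: "C \<in> carrier ?Q" "D \<in> carrier ?Q"
    then show "C \<oplus>\<^bsub>?Q\<^esub> D = D \<oplus>\<^bsub>?Q\<^esub> C"
      by (elim cE) (simp add: qa M.a_comm)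
    show "C \<oplus>\<^bsub>?Q\<^esub> D \<in> carrier ?Q"
      using CD by (elim cE) (simp add: qa ci)
  qed
  moreover have "left_module_axioms R ?Q"
  proof (rule left_module_axioms.intro)
    fix a C assume "a \<in> carrier R" "C \<in> carrier ?Q"
    then show "a \<odot>\<^bsub>?Q\<^esub> C \<in> carrier ?Q"
      by (elim cE) (simp add: qs ci)
  next
    fix C assume "C \<in> carrier ?Q"
    then show "\<one>\<^bsub>R\<^esub> \<odot>\<^bsub>?Q\<^esub> C = C"
      by (elim cE) (simp add: qs)
  next
    fix a C D assume "a \<in> carrier R" "C \<in> carrier ?Q" "D \<in> carrier ?Q"
    then show "a \<odot>\<^bsub>?Q\<^esub> (C \<oplus>\<^bsub>?Q\<^esub> D) = a \<odot>\<^bsub>?Q\<^esub> C \<oplus>\<^bsub>?Q\<^esub> a \<odot>\<^bsub>?Q\<^esub> D"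
      by (elim cE) (simp add: qa qs smult_r_distr)
  next
    fix a b C assume "a \<in> carrier R" "b \<in> carrier R" "C \<in> carrier ?Q"
    then show "(a \<oplus>\<^bsub>R\<^esub> b) \<odot>\<^bsub>?Q\<^esub> C = a \<odot>\<^bsub>?Q\<^esub> C \<oplus>\<^bsub>?Q\<^esub> b \<odot>\<^bsub>?Q\<^esub> C"
      by (elim cE) (simp add: qa qs smult_l_distr)
    show "(a \<otimes>\<^bsub>R\<^esub> b) \<odot>\<^bsub>?Q\<^esub> C = a \<odot>\<^bsub>?Q\<^esub> (b \<odot>\<^bsub>?Q\<^esub> C)"
      using \<open>a \<in> carrier R\<close> \<open>b \<in> carrier R\<close> \<open>C \<in> carrier ?Q\<close>
      by (elim cE) (simp add: qs smult_assoc1)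
  qed
  ultimately show ?thesis
    by (intro left_module.intro R.ring_axioms)
qed

end


section \<open>The group \<open>\<Psi>\<close>, the ring \<open>\<Lambda>\<close> and the module \<open>K\<^sub>\<beta>(w)\<close>\<close>

datatype 'a psi_gen = Plain 'a | Bullet 'a

definition Psi_gens :: "'a set \<Rightarrow> 'a psi_gen set" where
  "Psi_gens \<alpha> = Plain ` \<alpha> \<union> Bullet ` \<alpha>"

definition Psi_relations ::
    "'a set \<Rightarrow> ('a \<Rightarrow> 'a) \<Rightarrow> ('a psi_gen gword \<times> 'a psi_gen gword) set" where
  "Psi_relations \<alpha> \<tau> =
     (\<Union>a\<in>\<alpha>. {([(Plain a, True), (Bullet a, True)], [(Bullet a, True), (Plain a, True)]),
              ([(Plain a, True), (Plain (\<tau> a), True)], []),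
              ([(Bullet a, True), (Bullet (\<tau> a), True)], [])})"

definition Psi :: "'a set \<Rightarrow> ('a \<Rightarrow> 'a) \<Rightarrow> 'a psi_gen gword set monoid" where
  "Psi \<alpha> \<tau> = presented_group (Psi_gens \<alpha>) (Psi_relations \<alpha> \<tau>)"

definition Lam :: "'a set \<Rightarrow> ('a \<Rightarrow> 'a) \<Rightarrow> ('a psi_gen gword set \<Rightarrow>\<^sub>0 int) ring" where
  "Lam \<alpha> \<tau> = group_ring (Psi \<alpha> \<tau>)"

text \<open>The element of \<open>\<Lambda>\<close> given by a generator of \<open>\<Psi>\<close>.\<close>

definition lam_gen ::
    "'a set \<Rightarrow> ('a \<Rightarrow> 'a) \<Rightarrow> 'a psi_gen \<Rightarrow> 'a psi_gen gword set \<Rightarrow>\<^sub>0 int" where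
  "lam_gen \<alpha> \<tau> g = frag_of (pres_rel (Psi_gens \<alpha>) (Psi_relations \<alpha> \<tau>) `` {[(g, True)]})"

type_synonym 'a lam_vec = "nat \<Rightarrow> 'a psi_gen gword set \<Rightarrow>\<^sub>0 int"

definition K_ambient ::
    "'a set \<Rightarrow> ('a \<Rightarrow> 'a) \<Rightarrow> ('l, 'a) nanoword
     \<Rightarrow> ('a psi_gen gword set \<Rightarrow>\<^sub>0 int, 'a lam_vec) module" where
  "K_ambient \<alpha> \<tau> W = free_module (Lam \<alpha> \<tau>) {0..length (word W)}"

definition K_basis :: "'a set \<Rightarrow> ('a \<Rightarrow> 'a) \<Rightarrow> ('l, 'a) nanoword \<Rightarrow> nat \<Rightarrow> 'a lam_vec" where
  "K_basis \<alpha> \<tau> W = basis_vec (Lam \<alpha> \<tau>) {0..length (word W)}"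

text \<open>Positions \<open>i\<close>, \<open>j\<close> in a word are counted from 1, whereas list indices start at 0.\<close>

definition K_letter_relators ::
    "'a set \<Rightarrow> ('a \<Rightarrow> 'a) \<Rightarrow> 'a set \<Rightarrow> ('l, 'a) nanoword \<Rightarrow> 'l \<Rightarrow> nat \<Rightarrow> nat \<Rightarrow> 'a lam_vec set"
  where
  "K_letter_relators \<alpha> \<tau> \<beta> W A i j =
     (let R = Lam \<alpha> \<tau>; M = K_ambient \<alpha> \<tau> W; x = K_basis \<alpha> \<tau> W;
          a = lam_gen \<alpha> \<tau> (Plain (proj W A)); a\<^sub>b = lam_gen \<alpha> \<tau> (Bullet (proj W A));
          c = \<one>\<^bsub>R\<^esub> \<ominus>\<^bsub>R\<^esub> a \<otimes>\<^bsub>R\<^esub> a\<^sub>b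
      in if proj W A \<in> \<beta> then
           {a \<odot>\<^bsub>M\<^esub> x (i - 1) \<ominus>\<^bsub>M\<^esub> x i,
            c \<odot>\<^bsub>M\<^esub> x (i - 1) \<oplus>\<^bsub>M\<^esub> a\<^sub>b \<odot>\<^bsub>M\<^esub> x (j - 1) \<ominus>\<^bsub>M\<^esub> x j}
         else
           {a \<odot>\<^bsub>M\<^esub> x (j - 1) \<ominus>\<^bsub>M\<^esub> x j,
            a\<^sub>b \<odot>\<^bsub>M\<^esub> x (i - 1) \<ominus>\<^bsub>M\<^esub> x i \<oplus>\<^bsub>M\<^esub> c \<odot>\<^bsub>M\<^esub> x (j - 1)})"

definition K_relators ::
    "'a set \<Rightarrow> ('a \<Rightarrow> 'a) \<Rightarrow> 'a set \<Rightarrow> ('l, 'a) nanoword \<Rightarrow> 'a lam_vec set" where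
  "K_relators \<alpha> \<tau> \<beta> W =
     \<Union>{K_letter_relators \<alpha> \<tau> \<beta> W A i j | A i j.
        A \<in> letters W \<and> 1 \<le> i \<and> i < j \<and> j \<le> length (word W) \<and>
        word W ! (i - 1) = A \<and> word W ! (j - 1) = A}"

definition K_submodule ::
    "'a set \<Rightarrow> ('a \<Rightarrow> 'a) \<Rightarrow> 'a set \<Rightarrow> ('l, 'a) nanoword \<Rightarrow> 'a lam_vec set" where
  "K_submodule \<alpha> \<tau> \<beta> W =
     span_submodule (Lam \<alpha> \<tau>) (K_ambient \<alpha> \<tau> W) (K_relators \<alpha> \<tau> \<beta> W)"

definition K_module ::
    "'a set \<Rightarrow> ('a \<Rightarrow> 'a) \<Rightarrow> 'a set \<Rightarrow> ('l, 'a) nanoword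
     \<Rightarrow> ('a psi_gen gword set \<Rightarrow>\<^sub>0 int, 'a lam_vec set) module" where
  "K_module \<alpha> \<tau> \<beta> W =
     quotient_module (Lam \<alpha> \<tau>) (K_ambient \<alpha> \<tau> W) (K_submodule \<alpha> \<tau> \<beta> W)"

definition K_input :: "'a set \<Rightarrow> ('a \<Rightarrow> 'a) \<Rightarrow> 'a set \<Rightarrow> ('l, 'a) nanoword \<Rightarrow> 'a lam_vec set" where
  "K_input \<alpha> \<tau> \<beta> W = K_submodule \<alpha> \<tau> \<beta> W +>\<^bsub>K_ambient \<alpha> \<tau> W\<^esub> K_basis \<alpha> \<tau> W 0"

definition K_output :: "'a set \<Rightarrow> ('a \<Rightarrow> 'a) \<Rightarrow> 'a set \<Rightarrow> ('l, 'a) nanoword \<Rightarrow> 'a lam_vec set" where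
  "K_output \<alpha> \<tau> \<beta> W =
     K_submodule \<alpha> \<tau> \<beta> W +>\<^bsub>K_ambient \<alpha> \<tau> W\<^esub> K_basis \<alpha> \<tau> W (length (word W))"

lemma Lam_ring: "ring (Lam \<alpha> \<tau>)"
  by (simp add: Lam_def Psi_def group_ring_is_ring presented_group_is_group)

lemma lam_gen_carrier:
  assumes "g \<in> Psi_gens \<alpha>"
  shows "lam_gen \<alpha> \<tau> g \<in> carrier (Lam \<alpha> \<tau>)"
  using assms
  by (auto simp: Lam_def group_ring_def lam_gen_def Psi_def presented_group_def keys_frag_of
      intro: quotientI)

lemma K_module_left_module:
  assumes "is_nanoword \<alpha> W"
  shows "left_module (Lam \<alpha> \<tau>) (K_module \<alpha> \<tau> \<beta> W)"
proof -
  interpret R: ring "Lam \<alpha> \<tau>" by (rule Lam_ring)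
  interpret M: left_module "Lam \<alpha> \<tau>" "K_ambient \<alpha> \<tau> W"
    by (simp add: K_ambient_def free_module_left_module Lam_ring)
  have x: "K_basis \<alpha> \<tau> W k \<in> carrier (K_ambient \<alpha> \<tau> W)" for k
    by (simp add: K_basis_def K_ambient_def basis_vec_carrier Lam_ring)
  have "K_letter_relators \<alpha> \<tau> \<beta> W A i j \<subseteq> carrier (K_ambient \<alpha> \<tau> W)"
    if "A \<in> letters W" for A i j
  proof -
    have "proj W A \<in> \<alpha>" using that assms by (auto simp: is_nanoword_def)
    then have "lam_gen \<alpha> \<tau> (Plain (proj W A)) \<in> carrier (Lam \<alpha> \<tau>)"
        "lam_gen \<alpha> \<tau> (Bullet (proj W A)) \<in> carrier (Lam \<alpha> \<tau>)"
      by (auto intro!: lam_gen_carrier simp: Psi_gens_def)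
    with x show ?thesis by (auto simp: K_letter_relators_def Let_def)
  qed
  then have "K_relators \<alpha> \<tau> \<beta> W \<subseteq> carrier (K_ambient \<alpha> \<tau> W)"
    by (auto simp: K_relators_def)
  then show ?thesis
    by (simp add: K_module_def K_submodule_def M.quotient_left_module M.span_submodule_is_submodule)
qed

end

theory Submission
  imports Defs
begin

text \<open>
  A homomorphism from \<open>K\<^sub>\<beta>(W)\<close> to a left \<open>\<Lambda>\<close>-module \<open>N\<close> is the same thing as a labelling of the
  word by \<open>N\<close>: an element of \<open>N\<close> for each of the \<open>n + 1\<close> gaps before, between and after the \<open>n\<close>
  letters, subject to the two linear equations of every letter. The input and the output are the
  labels of the first and of the last gap in the universal labelling. By the argument of the Yoneda
  lemma (\<open>K_isomorphic_by_relabelling\<close>), two words have isomorphic triples as soon as their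
  labellings in every module correspond bijectively, compatibly with homomorphisms and with the same
  first and last label.

  A homotopy move changes a word only inside a few blocks of two adjacent letters. The equations of
  the remaining letters are the same before and after the move, so it is enough to study the
  equations of the two or three letters in the blocks (\<open>labelling_split\<close>). They are a small linear
  system, and solving it shows two things: the labels inside the blocks are determined by the labels
  entering the blocks, and the resulting relation between entering and leaving labels is the same on
  both sides of the move. For moves 1 and 2 it says that every block passes its entering label on
  unchanged. The computations are \<open>crossing_kink\<close>, \<open>crossing_kink_exchanged\<close>,
  \<open>crossing_cancelling_pair\<close> and \<open>crossing_triangle\<close>.

  The equations of a letter outside \<open>\<beta>\<close> are those of a letter in \<open>\<beta>\<close> with the roles of its two
  occurrences exchanged. This exchange turns the system of move 2 into itself with the two letters
  swapped; both letters are on the same side of \<open>\<beta>\<close> because \<open>\<tau>(\<beta>) = \<beta>\<close>. It turns the system of one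
  side of move 3 into that of the other side with the order of the three blocks reversed. Hence only
  move 1 needs a second computation, which uses that \<open>a\<close> and \<open>a\<^sub>\<bullet>\<close> are invertible in \<open>\<Lambda>\<close>.
\<close>

section \<open>Arithmetic and homomorphisms of left modules\<close>

context left_module
begin

lemma smult_zero_right: "a \<in> carrier R \<Longrightarrow> a \<odot>\<^bsub>M\<^esub> \<zero>\<^bsub>M\<^esub> = \<zero>\<^bsub>M\<^esub>"
  using smult_r_distr[of a "\<zero>\<^bsub>M\<^esub>" "\<zero>\<^bsub>M\<^esub>"]
  by (metis M.add.l_cancel_one' M.add.one_closed M.add.l_one smult_closed)

lemma smult_zero_left: "x \<in> carrier M \<Longrightarrow> \<zero>\<^bsub>R\<^esub> \<odot>\<^bsub>M\<^esub> x = \<zero>\<^bsub>M\<^esub>"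
  using smult_l_distr[of "\<zero>\<^bsub>R\<^esub>" "\<zero>\<^bsub>R\<^esub>" x]
  by (metis M.add.l_cancel_one' R.add.one_closed R.add.l_one smult_closed)

lemma smult_minus_right:
  assumes "a \<in> carrier R" "x \<in> carrier M"
  shows "a \<odot>\<^bsub>M\<^esub> (\<ominus>\<^bsub>M\<^esub> x) = \<ominus>\<^bsub>M\<^esub> (a \<odot>\<^bsub>M\<^esub> x)"
  using assms smult_r_distr[of a "\<ominus>\<^bsub>M\<^esub> x" x]
  by (intro M.add.inv_equality[symmetric]) (auto simp: M.l_neg smult_zero_right)

lemma smult_minus_left:
  assumes "a \<in> carrier R" "x \<in> carrier M"
  shows "(\<ominus>\<^bsub>R\<^esub> a) \<odot>\<^bsub>M\<^esub> x = \<ominus>\<^bsub>M\<^esub> (a \<odot>\<^bsub>M\<^esub> x)"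
  using assms smult_l_distr[of "\<ominus>\<^bsub>R\<^esub> a" a x]
  by (intro M.add.inv_equality[symmetric]) (auto simp: R.l_neg smult_zero_left)

lemma smult_one_minus:
  assumes "a \<in> carrier R" "b \<in> carrier R" "p \<in> carrier M"
  shows "(\<one>\<^bsub>R\<^esub> \<ominus>\<^bsub>R\<^esub> a \<otimes>\<^bsub>R\<^esub> b) \<odot>\<^bsub>M\<^esub> p = p \<ominus>\<^bsub>M\<^esub> a \<odot>\<^bsub>M\<^esub> (b \<odot>\<^bsub>M\<^esub> p)"
  using assms by (simp add: R.minus_eq M.minus_eq smult_l_distr smult_minus_left smult_assoc1)

lemma smult_commute:
  assumes "a \<in> carrier R" "b \<in> carrier R" "a \<otimes>\<^bsub>R\<^esub> b = b \<otimes>\<^bsub>R\<^esub> a" "x \<in> carrier M"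
  shows "b \<odot>\<^bsub>M\<^esub> (a \<odot>\<^bsub>M\<^esub> x) = a \<odot>\<^bsub>M\<^esub> (b \<odot>\<^bsub>M\<^esub> x)"
  using assms by (metis smult_assoc1)

lemma minus_eq_zero_iff:
  "x \<in> carrier M \<Longrightarrow> y \<in> carrier M \<Longrightarrow> x \<ominus>\<^bsub>M\<^esub> y = \<zero>\<^bsub>M\<^esub> \<longleftrightarrow> x = y"
  by (metis M.add.inv_closed M.add.inv_equality M.add.inv_inv M.minus_eq M.r_neg)

end

definition lin_hom ::
    "('r, 's) ring_scheme \<Rightarrow> ('r, 'm, 't) module_scheme \<Rightarrow> ('r, 'k, 'u) module_scheme \<Rightarrow> ('m \<Rightarrow> 'k) set"
  where
  "lin_hom R M N =
     {h \<in> hom (add_monoid M) (add_monoid N).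
        \<forall>r\<in>carrier R. \<forall>x\<in>carrier M. h (r \<odot>\<^bsub>M\<^esub> x) = r \<odot>\<^bsub>N\<^esub> h x}"

lemma lin_homI:
  assumes "\<And>x. x \<in> carrier M \<Longrightarrow> h x \<in> carrier N"
    and "\<And>x y. x \<in> carrier M \<Longrightarrow> y \<in> carrier M \<Longrightarrow> h (x \<oplus>\<^bsub>M\<^esub> y) = h x \<oplus>\<^bsub>N\<^esub> h y"
    and "\<And>r x. r \<in> carrier R \<Longrightarrow> x \<in> carrier M \<Longrightarrow> h (r \<odot>\<^bsub>M\<^esub> x) = r \<odot>\<^bsub>N\<^esub> h x"
  shows "h \<in> lin_hom R M N"
  using assms by (auto simp: lin_hom_def hom_def)

lemma lin_hom_closed: "h \<in> lin_hom R M N \<Longrightarrow> x \<in> carrier M \<Longrightarrow> h x \<in> carrier N"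
  and lin_hom_add:
    "h \<in> lin_hom R M N \<Longrightarrow> x \<in> carrier M \<Longrightarrow> y \<in> carrier M \<Longrightarrow> h (x \<oplus>\<^bsub>M\<^esub> y) = h x \<oplus>\<^bsub>N\<^esub> h y"
  and lin_hom_smult:
    "h \<in> lin_hom R M N \<Longrightarrow> r \<in> carrier R \<Longrightarrow> x \<in> carrier M \<Longrightarrow> h (r \<odot>\<^bsub>M\<^esub> x) = r \<odot>\<^bsub>N\<^esub> h x"
  by (auto simp: lin_hom_def hom_def)

lemma lin_hom_id: "(\<lambda>x. x) \<in> lin_hom R M M"
  by (rule lin_homI) auto

lemma lin_hom_compose:
  "h \<in> lin_hom R M N \<Longrightarrow> k \<in> lin_hom R N P \<Longrightarrow> (\<lambda>x. k (h x)) \<in> lin_hom R M P"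
  by (rule lin_homI) (simp_all add: lin_hom_closed lin_hom_add lin_hom_smult)

lemma lin_hom_minus:
  assumes "left_module R M" "left_module R N" "h \<in> lin_hom R M N" "x \<in> carrier M" "y \<in> carrier M"
  shows "h (x \<ominus>\<^bsub>M\<^esub> y) = h x \<ominus>\<^bsub>N\<^esub> h y"
proof -
  interpret M: left_module R M by fact
  interpret N: left_module R N by fact
  have "h (\<ominus>\<^bsub>M\<^esub> y) = h ((\<ominus>\<^bsub>R\<^esub> \<one>\<^bsub>R\<^esub>) \<odot>\<^bsub>M\<^esub> y)"
    using assms(5) by (simp add: M.smult_minus_left)
  also have "\<dots> = \<ominus>\<^bsub>N\<^esub> h y"
    using assms(3,5) by (simp add: lin_hom_smult N.smult_minus_left lin_hom_closed)
  finally show ?thesis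
    using assms(3-5) by (simp add: M.minus_eq N.minus_eq lin_hom_add)
qed

text \<open>
  With the zero map for \<open>k\<close> this is the statement that kernels are submodules; in general it reduces
  the equality of two homomorphisms to generators.
\<close>

lemma lin_hom_equalizer_submodule:
  assumes "left_module R M" "left_module R N" "h \<in> lin_hom R M N" "k \<in> lin_hom R M N"
  shows "submodule {x \<in> carrier M. h x = k x} R M"
proof -
  interpret M: left_module R M by fact
  interpret N: left_module R N by fact
  have z: "l \<zero>\<^bsub>M\<^esub> = \<zero>\<^bsub>N\<^esub>" if "l \<in> lin_hom R M N" for l
    using lin_hom_smult[OF that, of "\<zero>\<^bsub>R\<^esub>" "\<zero>\<^bsub>M\<^esub>"] lin_hom_closed[OF that, of "\<zero>\<^bsub>M\<^esub>"]
    by (simp add: M.smult_zero_left N.smult_zero_left)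
  have i: "l (\<ominus>\<^bsub>M\<^esub> x) = \<ominus>\<^bsub>N\<^esub> l x" if "l \<in> lin_hom R M N" "x \<in> carrier M" for l x
    using lin_hom_minus[OF assms(1,2) that(1) M.zero_closed that(2)] lin_hom_closed[OF that]
    by (simp add: M.minus_eq N.minus_eq z that)
  show ?thesis
  proof (intro submodule.intro submodule_axioms.intro M.add.subgroupI)
    show "{x \<in> carrier M. h x = k x} \<noteq> {}"
      using M.zero_closed assms(3,4) by (auto simp: z intro!: exI[of _ "\<zero>\<^bsub>M\<^esub>"])
  qed (use assms(3,4) in \<open>auto simp: lin_hom_add lin_hom_smult i a_inv_def[symmetric]\<close>)
qed

lemma module_iso_of_inverse_homs:
  assumes h: "h \<in> lin_hom R M N" and k: "k \<in> lin_hom R N M"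
    and kh: "\<And>x. x \<in> carrier M \<Longrightarrow> k (h x) = x" and hk: "\<And>y. y \<in> carrier N \<Longrightarrow> h (k y) = y"
  shows "h \<in> module_iso R M N"
proof -
  have "bij_betw h (carrier M) (carrier N)"
    by (rule bij_betw_byWitness[where f' = k]) (auto simp: kh hk intro: lin_hom_closed[OF h] lin_hom_closed[OF k])
  then show ?thesis
    using h by (simp add: module_iso_def lin_hom_def iso_def)
qed

text \<open>
  An element is the sum of the multiples of the basis vectors by its coordinates; the partial sums
  over \<open>J \<subseteq> I\<close> lie in \<open>U\<close> by induction on \<open>J\<close>.
\<close>

lemma free_module_generated:
  assumes "ring R" "finite I" and U: "submodule U R (free_module R I)"
    and basis: "\<And>k. k \<in> I \<Longrightarrow> basis_vec R I k \<in> U"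
  shows "carrier (free_module R I) \<subseteq> U"
proof
  interpret R: ring R by fact
  interpret U: submodule U R "free_module R I" by fact
  fix x assume x: "x \<in> carrier (free_module R I)"
  have xc: "x i \<in> carrier R" if "i \<in> I" for i
    using x that by (auto simp: free_module_def)
  define y where "y J = (\<lambda>i\<in>I. if i \<in> J then x i else \<zero>\<^bsub>R\<^esub>)" for J
  have "y J \<in> U" if "finite J" "J \<subseteq> I" for J
    using that
  proof (induction J rule: finite_induct)
    case empty
    then show ?case using U.one_closed by (simp add: free_module_def y_def restrict_def)
  next
    case (insert k J)
    then have "y J \<oplus>\<^bsub>free_module R I\<^esub> x k \<odot>\<^bsub>free_module R I\<^esub> basis_vec R I k \<in> U"
      using U.m_closed U.smult_closed basis xc by simp
    also have "y J \<oplus>\<^bsub>free_module R I\<^esub> x k \<odot>\<^bsub>free_module R I\<^esub> basis_vec R I k = y (insert k J)"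
      using insert xc by (auto simp: free_module_def basis_vec_def fun_eq_iff y_def)
    finally show ?case .
  qed
  from this[OF assms(2) order_refl] have "(\<lambda>i\<in>I. x i) \<in> U"
    by (simp add: y_def cong: restrict_cong)
  moreover have "(\<lambda>i\<in>I. x i) = x"
    using x by (auto simp: free_module_def PiE_def extensional_restrict)
  ultimately show "x \<in> U" by simp
qed

lemma free_module_extend:
  assumes "left_module R N" "finite I" and v: "\<And>k. k \<in> I \<Longrightarrow> v k \<in> carrier N"
  obtains \<phi> where "\<phi> \<in> lin_hom R (free_module R I) N" "\<And>k. k \<in> I \<Longrightarrow> \<phi> (basis_vec R I k) = v k"
proof
  interpret N: left_module R N by fact
  let ?F = "free_module R I" and ?\<phi> = "\<lambda>x. \<Oplus>\<^bsub>N\<^esub>i\<in>I. x i \<odot>\<^bsub>N\<^esub> v i"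
  have c: "x i \<in> carrier R" if "x \<in> carrier ?F" "i \<in> I" for x i
    using that by (auto simp: free_module_def)
  have smult_sum: "(\<Oplus>\<^bsub>N\<^esub>i\<in>J. r \<odot>\<^bsub>N\<^esub> f i) = r \<odot>\<^bsub>N\<^esub> (\<Oplus>\<^bsub>N\<^esub>i\<in>J. f i)"
    if "finite J" "r \<in> carrier R" "f \<in> J \<rightarrow> carrier N" for J r f
    using that by (induction J rule: finite_induct)
      (auto simp: N.M.finsum_insert N.smult_r_distr N.smult_zero_right Pi_def)
  show "?\<phi> \<in> lin_hom R ?F N"
  proof (rule lin_homI)
    fix x y assume xy: "x \<in> carrier ?F" "y \<in> carrier ?F"
    show "?\<phi> x \<in> carrier N"
      using xy v by (auto intro!: N.M.finsum_closed simp: c)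
    have "?\<phi> (x \<oplus>\<^bsub>?F\<^esub> y) = (\<Oplus>\<^bsub>N\<^esub>i\<in>I. x i \<odot>\<^bsub>N\<^esub> v i \<oplus>\<^bsub>N\<^esub> y i \<odot>\<^bsub>N\<^esub> v i)"
      using xy v by (intro N.M.finsum_cong') (auto simp: free_module_def N.smult_l_distr PiE_iff)
    also have "\<dots> = ?\<phi> x \<oplus>\<^bsub>N\<^esub> ?\<phi> y"
      using xy v by (intro N.M.finsum_addf) (auto simp: c)
    finally show "?\<phi> (x \<oplus>\<^bsub>?F\<^esub> y) = ?\<phi> x \<oplus>\<^bsub>N\<^esub> ?\<phi> y" .
    fix r assume r: "r \<in> carrier R"
    have "?\<phi> (r \<odot>\<^bsub>?F\<^esub> x) = (\<Oplus>\<^bsub>N\<^esub>i\<in>I. r \<odot>\<^bsub>N\<^esub> (x i \<odot>\<^bsub>N\<^esub> v i))"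
      using xy v r by (intro N.M.finsum_cong') (auto simp: free_module_def N.smult_assoc1 PiE_iff)
    also have "\<dots> = r \<odot>\<^bsub>N\<^esub> ?\<phi> x"
      using xy v r assms(2) by (intro smult_sum) (auto simp: c)
    finally show "?\<phi> (r \<odot>\<^bsub>?F\<^esub> x) = r \<odot>\<^bsub>N\<^esub> ?\<phi> x" .
  qed
  show "?\<phi> (basis_vec R I k) = v k" if k: "k \<in> I" for k
  proof -
    have "?\<phi> (basis_vec R I k) = (\<Oplus>\<^bsub>N\<^esub>i\<in>I. if k = i then v i else \<zero>\<^bsub>N\<^esub>)"
      using v by (intro N.M.finsum_cong') (auto simp: basis_vec_def N.smult_zero_left)
    also have "\<dots> = v k"
      using k v assms(2) by (intro N.M.finsum_singleton) auto
    finally show ?thesis .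
  qed
qed

lemma quotient_carrier:
  "carrier (quotient_module R M N) = (\<lambda>v. N +>\<^bsub>M\<^esub> v) ` carrier M"
  by (auto simp: quotient_module_def A_RCOSETS_def')

lemma quotient_projection:
  assumes "left_module R M" "submodule N R M"
  shows "(\<lambda>v. N +>\<^bsub>M\<^esub> v) \<in> lin_hom R M (quotient_module R M N)"
proof -
  interpret M: left_module R M by fact
  show ?thesis
    using assms(2) by (intro lin_homI) (auto simp: quotient_carrier M.quotient_add M.quotient_smult)
qed

text \<open>
  The lift picks the only value that \<open>\<phi>\<close> takes on a coset.
\<close>

lemma quotient_lift:
  assumes "left_module R M" "left_module R P" "submodule N R M"
    and \<phi>: "\<phi> \<in> lin_hom R M P" and ker: "\<And>x. x \<in> N \<Longrightarrow> \<phi> x = \<zero>\<^bsub>P\<^esub>"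
  obtains h where "h \<in> lin_hom R (quotient_module R M N) P"
    "\<And>x. x \<in> carrier M \<Longrightarrow> h (N +>\<^bsub>M\<^esub> x) = \<phi> x"
proof
  interpret M: left_module R M by fact
  interpret P: left_module R P by fact
  interpret N: submodule N R M by fact
  have sub: "N \<subseteq> carrier M" using N.subset by simp
  let ?h = "\<lambda>C. the_elem (\<phi> ` C)"
  show h: "?h (N +>\<^bsub>M\<^esub> x) = \<phi> x" if "x \<in> carrier M" for x
  proof -
    have "\<phi> (n \<oplus>\<^bsub>M\<^esub> x) = \<phi> x" if "n \<in> N" for n
      using that \<open>x \<in> carrier M\<close> sub by (auto simp: lin_hom_add[OF \<phi>] ker lin_hom_closed[OF \<phi>])
    moreover have "N +>\<^bsub>M\<^esub> x = (\<lambda>n. n \<oplus>\<^bsub>M\<^esub> x) ` N"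
      by (auto simp: a_r_coset_def')
    moreover have "N \<noteq> {}"
      using N.one_closed by blast
    ultimately have "\<phi> ` (N +>\<^bsub>M\<^esub> x) = {\<phi> x}"
      by (simp add: image_image image_constant_conv cong: image_cong)
    then show ?thesis by simp
  qed
  note q = M.quotient_add[OF assms(3)] M.quotient_smult[OF assms(3)]
  show "?h \<in> lin_hom R (quotient_module R M N) P"
  proof (rule lin_homI)
    fix C D assume "C \<in> carrier (quotient_module R M N)" "D \<in> carrier (quotient_module R M N)"
    then obtain x y where x: "x \<in> carrier M" "C = N +>\<^bsub>M\<^esub> x" and y: "y \<in> carrier M" "D = N +>\<^bsub>M\<^esub> y"
      by (auto simp: quotient_carrier)
    show "?h C \<in> carrier P"
      by (simp only: x h lin_hom_closed[OF \<phi>])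
    show "?h (C \<oplus>\<^bsub>quotient_module R M N\<^esub> D) = ?h C \<oplus>\<^bsub>P\<^esub> ?h D"
      by (simp only: x y h q lin_hom_add[OF \<phi>] M.M.a_closed)
    show "?h (r \<odot>\<^bsub>quotient_module R M N\<^esub> C) = r \<odot>\<^bsub>P\<^esub> ?h C" if "r \<in> carrier R" for r
      by (simp only: x h q lin_hom_smult[OF \<phi>] M.smult_closed that)
  qed
qed

lemma presented_module_lift:
  fixes R :: "('r, 's) ring_scheme" and I :: "'i set"
  defines "F \<equiv> free_module R I"
  assumes "left_module R P" and S: "S \<subseteq> carrier F"
    and \<phi>: "\<phi> \<in> lin_hom R F P" and ker: "\<And>x. x \<in> S \<Longrightarrow> \<phi> x = \<zero>\<^bsub>P\<^esub>"
  obtains h where "h \<in> lin_hom R (quotient_module R F (span_submodule R F S)) P"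
    "\<And>x. x \<in> carrier F \<Longrightarrow> h (span_submodule R F S +>\<^bsub>F\<^esub> x) = \<phi> x"
proof -
  interpret P: left_module R P by fact
  interpret F: left_module R F
    unfolding F_def by (rule free_module_left_module) (rule P.R.ring_axioms)
  have "(\<lambda>_. \<zero>\<^bsub>P\<^esub>) \<in> lin_hom R F P"
    by (rule lin_homI) (auto simp: P.smult_zero_right)
  then have "submodule {x \<in> carrier F. \<phi> x = \<zero>\<^bsub>P\<^esub>} R F"
    using lin_hom_equalizer_submodule[OF F.left_module_axioms assms(2) \<phi>] by simp
  then have "span_submodule R F S \<subseteq> {x \<in> carrier F. \<phi> x = \<zero>\<^bsub>P\<^esub>}"
    unfolding span_submodule_def using S ker by (intro hull_minimal) auto
  then show ?thesis
    using that quotient_lift[OF F.left_module_axioms assms(2) F.span_submodule_is_submodule[OF S] \<phi>]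
    by blast
qed

lemma presented_module_hom_eqI:
  fixes R :: "('r, 's) ring_scheme" and I :: "'i set"
  defines "F \<equiv> free_module R I"
  assumes "left_module R P" "finite I" and N: "submodule N R F"
    and h: "h \<in> lin_hom R (quotient_module R F N) P" and k: "k \<in> lin_hom R (quotient_module R F N) P"
    and eq: "\<And>i. i \<in> I \<Longrightarrow> h (N +>\<^bsub>F\<^esub> basis_vec R I i) = k (N +>\<^bsub>F\<^esub> basis_vec R I i)"
    and x: "x \<in> carrier (quotient_module R F N)"
  shows "h x = k x"
proof -
  interpret P: left_module R P by fact
  interpret F: left_module R F
    unfolding F_def by (rule free_module_left_module) (rule P.R.ring_axioms)
  note \<pi> = quotient_projection[OF F.left_module_axioms N]
  have "submodule {v \<in> carrier F. h (N +>\<^bsub>F\<^esub> v) = k (N +>\<^bsub>F\<^esub> v)} R F"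
    by (rule lin_hom_equalizer_submodule[OF F.left_module_axioms assms(2)
          lin_hom_compose[OF \<pi> h] lin_hom_compose[OF \<pi> k]])
  then have "carrier F \<subseteq> {v \<in> carrier F. h (N +>\<^bsub>F\<^esub> v) = k (N +>\<^bsub>F\<^esub> v)}"
    unfolding F_def using eq assms(3)
    by (intro free_module_generated) (auto simp: F_def basis_vec_carrier P.R.ring_axioms)
  then show ?thesis
    using x by (auto simp: quotient_carrier)
qed

section \<open>The linear equations of a letter\<close>

text \<open>
  The equations of a letter in \<open>\<beta>\<close>: \<open>p\<close> and \<open>q\<close> are the labels before and after its first
  occurrence, \<open>r\<close> and \<open>s\<close> those around the second. The map sending \<open>(p, r)\<close> to \<open>(q, s)\<close> is the
  switch of the Alexander biquandle, the module form of the Burau representation.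
\<close>

definition crossing ::
    "('r, 's) ring_scheme \<Rightarrow> ('r, 'm, 't) module_scheme \<Rightarrow> 'r \<Rightarrow> 'r \<Rightarrow> 'm \<Rightarrow> 'm \<Rightarrow> 'm \<Rightarrow> 'm \<Rightarrow> bool"
  where
  "crossing R N a b p q r s \<longleftrightarrow>
     q = a \<odot>\<^bsub>N\<^esub> p \<and>
     s = (\<one>\<^bsub>R\<^esub> \<ominus>\<^bsub>R\<^esub> a \<otimes>\<^bsub>R\<^esub> b) \<odot>\<^bsub>N\<^esub> p \<oplus>\<^bsub>N\<^esub> b \<odot>\<^bsub>N\<^esub> r"

context left_module
begin

lemma crossing_iff:
  assumes "a \<in> carrier R" "b \<in> carrier R" "p \<in> carrier M" "r \<in> carrier M"
  shows "crossing R M a b p q r s \<longleftrightarrow>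
    q = a \<odot>\<^bsub>M\<^esub> p \<and> s = p \<ominus>\<^bsub>M\<^esub> a \<odot>\<^bsub>M\<^esub> (b \<odot>\<^bsub>M\<^esub> p) \<oplus>\<^bsub>M\<^esub> b \<odot>\<^bsub>M\<^esub> r"
  using assms by (simp add: crossing_def smult_one_minus)

text \<open>
  With \<open>q = a p\<close> the second equation reads \<open>r = p - a b p + b a p\<close>, and \<open>a\<close> commutes with \<open>b\<close>.
\<close>

lemma crossing_kink:
  assumes ab: "a \<in> carrier R" "b \<in> carrier R" "a \<otimes>\<^bsub>R\<^esub> b = b \<otimes>\<^bsub>R\<^esub> a"
    and "p \<in> carrier M" "q \<in> carrier M" "r \<in> carrier M"
  shows "crossing R M a b p q q r \<longleftrightarrow> q = a \<odot>\<^bsub>M\<^esub> p \<and> r = p"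
  using assms by (auto simp: crossing_iff smult_commute[OF ab] M.minus_eq M.a_assoc M.l_neg)

text \<open>
  The same letter with its occurrences exchanged. Here the second equation only says \<open>b r = b p\<close>, and
  the first one expresses \<open>r\<close> by the inner label \<open>q\<close>; both have to be solved by inverting a scalar.
\<close>

lemma crossing_kink_exchanged:
  assumes ab: "a \<in> carrier R" "b \<in> carrier R" "a \<otimes>\<^bsub>R\<^esub> b = b \<otimes>\<^bsub>R\<^esub> a"
    and a': "a' \<in> carrier R" "a' \<otimes>\<^bsub>R\<^esub> a = \<one>\<^bsub>R\<^esub>" "a \<otimes>\<^bsub>R\<^esub> a' = \<one>\<^bsub>R\<^esub>"
    and b': "b' \<in> carrier R" "b' \<otimes>\<^bsub>R\<^esub> b = \<one>\<^bsub>R\<^esub>"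
    and pqr: "p \<in> carrier M" "q \<in> carrier M" "r \<in> carrier M"
  shows "crossing R M a b q r p q \<longleftrightarrow> q = a' \<odot>\<^bsub>M\<^esub> p \<and> r = p"
proof -
  have a'a: "a' \<odot>\<^bsub>M\<^esub> (a \<odot>\<^bsub>M\<^esub> x) = x" "a \<odot>\<^bsub>M\<^esub> (a' \<odot>\<^bsub>M\<^esub> x) = x" "b' \<odot>\<^bsub>M\<^esub> (b \<odot>\<^bsub>M\<^esub> x) = x"
    if "x \<in> carrier M" for x
    using that a' b' ab smult_assoc1 smult_one by metis+
  show ?thesis
  proof
    assume c: "crossing R M a b q r p q"
    then have r: "r = a \<odot>\<^bsub>M\<^esub> q" and "q = q \<ominus>\<^bsub>M\<^esub> b \<odot>\<^bsub>M\<^esub> r \<oplus>\<^bsub>M\<^esub> b \<odot>\<^bsub>M\<^esub> p"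
      using ab pqr by (auto simp: crossing_iff smult_commute[OF ab])
    then have "\<ominus>\<^bsub>M\<^esub> (b \<odot>\<^bsub>M\<^esub> r) \<oplus>\<^bsub>M\<^esub> b \<odot>\<^bsub>M\<^esub> p = \<zero>\<^bsub>M\<^esub>"
      using ab pqr by (metis M.add.inv_closed M.add.l_cancel_one' M.add.m_closed M.a_assoc M.minus_eq smult_closed)
    then have "b \<odot>\<^bsub>M\<^esub> r = b \<odot>\<^bsub>M\<^esub> p"
      using ab pqr
      by (metis M.add.inv_closed M.add.inv_equality M.add.inv_inv M.a_comm smult_closed)
    then show "q = a' \<odot>\<^bsub>M\<^esub> p \<and> r = p"
      using a'a pqr r by metis
  next
    assume "q = a' \<odot>\<^bsub>M\<^esub> p \<and> r = p"
    then show "crossing R M a b q r p q"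
      using ab a' pqr a'a
      by (auto simp: crossing_iff M.minus_eq M.a_assoc M.l_neg smult_commute[OF ab, symmetric])
  qed
qed

text \<open>
  The first equations give \<open>r = a' a p = p\<close>. Substituting \<open>s'\<close> in the last equation leaves
  \<open>t = p - a b p + b (1 - a' b') a p + b b' s\<close>, where the multiples of \<open>p\<close> cancel because
  \<open>b a' b' a = 1\<close>.
\<close>

lemma crossing_cancelling_pair:
  assumes ab: "a \<in> carrier R" "b \<in> carrier R" "a \<otimes>\<^bsub>R\<^esub> b = b \<otimes>\<^bsub>R\<^esub> a"
    and a': "a' \<in> carrier R" "a' \<otimes>\<^bsub>R\<^esub> a = \<one>\<^bsub>R\<^esub>"
    and b': "b' \<in> carrier R" "b \<otimes>\<^bsub>R\<^esub> b' = \<one>\<^bsub>R\<^esub>" "b' \<otimes>\<^bsub>R\<^esub> b = \<one>\<^bsub>R\<^esub>" 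
    and comm: "a' \<otimes>\<^bsub>R\<^esub> b' = b' \<otimes>\<^bsub>R\<^esub> a'"
    and p: "p \<in> carrier M" "q \<in> carrier M" "r \<in> carrier M"
    and s: "s \<in> carrier M" "s' \<in> carrier M" "t \<in> carrier M"
  shows "crossing R M a b p q s' t \<and> crossing R M a' b' q r s s' \<longleftrightarrow>
     r = p \<and> t = s \<and> q = a \<odot>\<^bsub>M\<^esub> p \<and>
     s' = (\<one>\<^bsub>R\<^esub> \<ominus>\<^bsub>R\<^esub> a' \<otimes>\<^bsub>R\<^esub> b') \<odot>\<^bsub>M\<^esub> (a \<odot>\<^bsub>M\<^esub> p) \<oplus>\<^bsub>M\<^esub> b' \<odot>\<^bsub>M\<^esub> s"
proof -
  have inv: "a' \<odot>\<^bsub>M\<^esub> (a \<odot>\<^bsub>M\<^esub> x) = x" "b' \<odot>\<^bsub>M\<^esub> (b \<odot>\<^bsub>M\<^esub> x) = x" "b \<odot>\<^bsub>M\<^esub> (b' \<odot>\<^bsub>M\<^esub> x) = x"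
    if "x \<in> carrier M" for x
    using that a' b' ab smult_assoc1 smult_one by metis+
  have "b \<odot>\<^bsub>M\<^esub> ((\<one>\<^bsub>R\<^esub> \<ominus>\<^bsub>R\<^esub> a' \<otimes>\<^bsub>R\<^esub> b') \<odot>\<^bsub>M\<^esub> (a \<odot>\<^bsub>M\<^esub> p) \<oplus>\<^bsub>M\<^esub> b' \<odot>\<^bsub>M\<^esub> s)
      = a \<odot>\<^bsub>M\<^esub> (b \<odot>\<^bsub>M\<^esub> p) \<ominus>\<^bsub>M\<^esub> p \<oplus>\<^bsub>M\<^esub> s"
    using ab a' b' p s
    by (simp add: smult_one_minus smult_r_distr M.minus_eq smult_minus_right inv
        smult_commute[OF ab] smult_commute[OF a'(1) b'(1) comm, symmetric])
  moreover have "p \<ominus>\<^bsub>M\<^esub> y \<oplus>\<^bsub>M\<^esub> (y \<ominus>\<^bsub>M\<^esub> p \<oplus>\<^bsub>M\<^esub> s) = s" if "y \<in> carrier M" for y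
    using p s that by (simp add: M.minus_eq M.a_assoc M.r_neg1 M.r_neg2)
  ultimately show ?thesis
    using ab a' b' p s by (auto simp: crossing_iff inv smult_one_minus)
qed

text \<open>
  The two sides of move 3, solved for the inner labels \<open>q\<^sub>i\<close>. That the relations on the outer labels
  \<open>p\<^sub>i\<close>, \<open>r\<^sub>i\<close> agree is the Yang-Baxter equation for the switch. With \<open>c = 1 - a b\<close> it comes down to
  \<open>c\<^sup>2 + a b c = c\<close> and to the commutation of \<open>a\<close>, \<open>b\<close> and \<open>c\<close>.
\<close>

lemma crossing_triangle:
  assumes ab: "a \<in> carrier R" "b \<in> carrier R" "a \<otimes>\<^bsub>R\<^esub> b = b \<otimes>\<^bsub>R\<^esub> a"
    and p: "p1 \<in> carrier M" "p2 \<in> carrier M" "p3 \<in> carrier M"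
    and q: "q1 \<in> carrier M" "q2 \<in> carrier M" "q3 \<in> carrier M"
    and r: "r1 \<in> carrier M" "r2 \<in> carrier M" "r3 \<in> carrier M"
  shows "crossing R M a b p1 q1 p2 q2 \<and> crossing R M a b q1 r1 p3 q3 \<and> crossing R M a b q2 r2 q3 r3
    \<longleftrightarrow> q1 = a \<odot>\<^bsub>M\<^esub> p1 \<and>
        q2 = (\<one>\<^bsub>R\<^esub> \<ominus>\<^bsub>R\<^esub> a \<otimes>\<^bsub>R\<^esub> b) \<odot>\<^bsub>M\<^esub> p1 \<oplus>\<^bsub>M\<^esub> b \<odot>\<^bsub>M\<^esub> p2 \<and>
        q3 = (\<one>\<^bsub>R\<^esub> \<ominus>\<^bsub>R\<^esub> a \<otimes>\<^bsub>R\<^esub> b) \<odot>\<^bsub>M\<^esub> (a \<odot>\<^bsub>M\<^esub> p1) \<oplus>\<^bsub>M\<^esub> b \<odot>\<^bsub>M\<^esub> p3 \<and>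
        r1 = a \<odot>\<^bsub>M\<^esub> (a \<odot>\<^bsub>M\<^esub> p1) \<and>
        r2 = (\<one>\<^bsub>R\<^esub> \<ominus>\<^bsub>R\<^esub> a \<otimes>\<^bsub>R\<^esub> b) \<odot>\<^bsub>M\<^esub> (a \<odot>\<^bsub>M\<^esub> p1) \<oplus>\<^bsub>M\<^esub> b \<odot>\<^bsub>M\<^esub> (a \<odot>\<^bsub>M\<^esub> p2) \<and>
        r3 = (\<one>\<^bsub>R\<^esub> \<ominus>\<^bsub>R\<^esub> a \<otimes>\<^bsub>R\<^esub> b) \<odot>\<^bsub>M\<^esub> p1 \<oplus>\<^bsub>M\<^esub>
             b \<odot>\<^bsub>M\<^esub> ((\<one>\<^bsub>R\<^esub> \<ominus>\<^bsub>R\<^esub> a \<otimes>\<^bsub>R\<^esub> b) \<odot>\<^bsub>M\<^esub> p2 \<oplus>\<^bsub>M\<^esub> b \<odot>\<^bsub>M\<^esub> p3)" (is ?A)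
   and "crossing R M a b p1 q1 q3 r3 \<and> crossing R M a b q1 r1 q2 r2 \<and> crossing R M a b p2 q2 p3 q3
    \<longleftrightarrow> q1 = a \<odot>\<^bsub>M\<^esub> p1 \<and> q2 = a \<odot>\<^bsub>M\<^esub> p2 \<and>
        q3 = (\<one>\<^bsub>R\<^esub> \<ominus>\<^bsub>R\<^esub> a \<otimes>\<^bsub>R\<^esub> b) \<odot>\<^bsub>M\<^esub> p2 \<oplus>\<^bsub>M\<^esub> b \<odot>\<^bsub>M\<^esub> p3 \<and>
        r1 = a \<odot>\<^bsub>M\<^esub> (a \<odot>\<^bsub>M\<^esub> p1) \<and>
        r2 = (\<one>\<^bsub>R\<^esub> \<ominus>\<^bsub>R\<^esub> a \<otimes>\<^bsub>R\<^esub> b) \<odot>\<^bsub>M\<^esub> (a \<odot>\<^bsub>M\<^esub> p1) \<oplus>\<^bsub>M\<^esub> b \<odot>\<^bsub>M\<^esub> (a \<odot>\<^bsub>M\<^esub> p2) \<and>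
        r3 = (\<one>\<^bsub>R\<^esub> \<ominus>\<^bsub>R\<^esub> a \<otimes>\<^bsub>R\<^esub> b) \<odot>\<^bsub>M\<^esub> p1 \<oplus>\<^bsub>M\<^esub>
             b \<odot>\<^bsub>M\<^esub> ((\<one>\<^bsub>R\<^esub> \<ominus>\<^bsub>R\<^esub> a \<otimes>\<^bsub>R\<^esub> b) \<odot>\<^bsub>M\<^esub> p2 \<oplus>\<^bsub>M\<^esub> b \<odot>\<^bsub>M\<^esub> p3)" (is ?B)
proof -
  show ?B by (auto simp: crossing_def)
  let ?c = "\<one>\<^bsub>R\<^esub> \<ominus>\<^bsub>R\<^esub> a \<otimes>\<^bsub>R\<^esub> b"
  have c: "?c \<in> carrier R" using ab by simp
  have ba: "b \<odot>\<^bsub>M\<^esub> (a \<odot>\<^bsub>M\<^esub> x) = a \<odot>\<^bsub>M\<^esub> (b \<odot>\<^bsub>M\<^esub> x)" if "x \<in> carrier M" for x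
    using smult_commute[OF ab] that by simp
  have ac: "a \<odot>\<^bsub>M\<^esub> (?c \<odot>\<^bsub>M\<^esub> x) = ?c \<odot>\<^bsub>M\<^esub> (a \<odot>\<^bsub>M\<^esub> x)" if "x \<in> carrier M" for x
    using ab that by (simp add: smult_one_minus smult_r_distr smult_minus_right M.minus_eq ba)
  have bc: "?c \<odot>\<^bsub>M\<^esub> (b \<odot>\<^bsub>M\<^esub> x) = b \<odot>\<^bsub>M\<^esub> (?c \<odot>\<^bsub>M\<^esub> x)" if "x \<in> carrier M" for x
    using ab that by (simp add: smult_one_minus smult_r_distr smult_minus_right M.minus_eq ba)
  have cc: "?c \<odot>\<^bsub>M\<^esub> (?c \<odot>\<^bsub>M\<^esub> x) \<oplus>\<^bsub>M\<^esub> b \<odot>\<^bsub>M\<^esub> (?c \<odot>\<^bsub>M\<^esub> (a \<odot>\<^bsub>M\<^esub> x)) = ?c \<odot>\<^bsub>M\<^esub> x"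
    if x: "x \<in> carrier M" for x
  proof -
    have "?c \<odot>\<^bsub>M\<^esub> (?c \<odot>\<^bsub>M\<^esub> x) = ?c \<odot>\<^bsub>M\<^esub> x \<ominus>\<^bsub>M\<^esub> a \<odot>\<^bsub>M\<^esub> (b \<odot>\<^bsub>M\<^esub> (?c \<odot>\<^bsub>M\<^esub> x))"
      using ab c x by (intro smult_one_minus) auto
    then show ?thesis
      using ab(1,2) c x by (simp add: ac[symmetric] ba M.minus_eq M.a_assoc M.l_neg)
  qed
  have r2: "a \<odot>\<^bsub>M\<^esub> (?c \<odot>\<^bsub>M\<^esub> p1 \<oplus>\<^bsub>M\<^esub> b \<odot>\<^bsub>M\<^esub> p2) = ?c \<odot>\<^bsub>M\<^esub> (a \<odot>\<^bsub>M\<^esub> p1) \<oplus>\<^bsub>M\<^esub> b \<odot>\<^bsub>M\<^esub> (a \<odot>\<^bsub>M\<^esub> p2)"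
    using ab(1,2) c p by (simp add: smult_r_distr ac ba)
  have "?c \<odot>\<^bsub>M\<^esub> (?c \<odot>\<^bsub>M\<^esub> p1 \<oplus>\<^bsub>M\<^esub> b \<odot>\<^bsub>M\<^esub> p2) \<oplus>\<^bsub>M\<^esub> b \<odot>\<^bsub>M\<^esub> (?c \<odot>\<^bsub>M\<^esub> (a \<odot>\<^bsub>M\<^esub> p1) \<oplus>\<^bsub>M\<^esub> b \<odot>\<^bsub>M\<^esub> p3)
      = (?c \<odot>\<^bsub>M\<^esub> (?c \<odot>\<^bsub>M\<^esub> p1) \<oplus>\<^bsub>M\<^esub> b \<odot>\<^bsub>M\<^esub> (?c \<odot>\<^bsub>M\<^esub> (a \<odot>\<^bsub>M\<^esub> p1)))
        \<oplus>\<^bsub>M\<^esub> b \<odot>\<^bsub>M\<^esub> (?c \<odot>\<^bsub>M\<^esub> p2 \<oplus>\<^bsub>M\<^esub> b \<odot>\<^bsub>M\<^esub> p3)"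
    using ab(1,2) c p by (simp add: smult_r_distr bc M.a_ac)
  then have r3: "?c \<odot>\<^bsub>M\<^esub> (?c \<odot>\<^bsub>M\<^esub> p1 \<oplus>\<^bsub>M\<^esub> b \<odot>\<^bsub>M\<^esub> p2) \<oplus>\<^bsub>M\<^esub> b \<odot>\<^bsub>M\<^esub> (?c \<odot>\<^bsub>M\<^esub> (a \<odot>\<^bsub>M\<^esub> p1) \<oplus>\<^bsub>M\<^esub> b \<odot>\<^bsub>M\<^esub> p3)
      = ?c \<odot>\<^bsub>M\<^esub> p1 \<oplus>\<^bsub>M\<^esub> b \<odot>\<^bsub>M\<^esub> (?c \<odot>\<^bsub>M\<^esub> p2 \<oplus>\<^bsub>M\<^esub> b \<odot>\<^bsub>M\<^esub> p3)"
    using cc p by simp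
  show ?A using r2 r3 by (auto simp: crossing_def)
qed

end

section \<open>Relations between the generators of \<open>\<Lambda>\<close>\<close>

lemma lam_gen_mult:
  assumes "g \<in> Psi_gens \<alpha>" "h \<in> Psi_gens \<alpha>"
  shows "lam_gen \<alpha> \<tau> g \<otimes>\<^bsub>Lam \<alpha> \<tau>\<^esub> lam_gen \<alpha> \<tau> h =
    frag_of (pres_rel (Psi_gens \<alpha>) (Psi_relations \<alpha> \<tau>) `` {[(g, True), (h, True)]})"
  using assms by (simp add: lam_gen_def Lam_def group_ring_def Psi_def presented_group_mult)

lemma presented_relation:
  assumes "(l, r) \<in> Q" "l \<in> gwords X" "r \<in> gwords X"
  shows "pres_rel X Q `` {l} = pres_rel X Q `` {r}"
proof (rule equiv_class_eq[OF equiv_pres_rel])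
  have "pres_step X Q ([] @ l @ []) ([] @ r @ [])"
    by (rule pres_step.rel) (use assms in auto)
  then show "(l, r) \<in> pres_rel X Q"
    using assms by (auto simp: pres_rel_def)
qed

lemma Plain_Bullet_carrier:
  assumes "a \<in> \<alpha>"
  shows "lam_gen \<alpha> \<tau> (Plain a) \<in> carrier (Lam \<alpha> \<tau>)" "lam_gen \<alpha> \<tau> (Bullet a) \<in> carrier (Lam \<alpha> \<tau>)"
  using assms by (auto intro!: lam_gen_carrier simp: Psi_gens_def)

lemma Plain_Bullet_commute:
  assumes "a \<in> \<alpha>"
  shows "lam_gen \<alpha> \<tau> (Plain a) \<otimes>\<^bsub>Lam \<alpha> \<tau>\<^esub> lam_gen \<alpha> \<tau> (Bullet a) =
    lam_gen \<alpha> \<tau> (Bullet a) \<otimes>\<^bsub>Lam \<alpha> \<tau>\<^esub> lam_gen \<alpha> \<tau> (Plain a)"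
proof -
  have g: "Plain a \<in> Psi_gens \<alpha>" "Bullet a \<in> Psi_gens \<alpha>"
    using assms by (auto simp: Psi_gens_def)
  then show ?thesis
    unfolding lam_gen_mult[OF g] lam_gen_mult[OF g(2,1)]
    using assms by (intro arg_cong[of _ _ frag_of] presented_relation) (auto simp: Psi_relations_def)
qed

lemma Plain_Bullet_inverse:
  assumes "a \<in> \<alpha>" "\<tau> a \<in> \<alpha>"
  shows "lam_gen \<alpha> \<tau> (Plain a) \<otimes>\<^bsub>Lam \<alpha> \<tau>\<^esub> lam_gen \<alpha> \<tau> (Plain (\<tau> a)) = \<one>\<^bsub>Lam \<alpha> \<tau>\<^esub>"
    and "lam_gen \<alpha> \<tau> (Bullet a) \<otimes>\<^bsub>Lam \<alpha> \<tau>\<^esub> lam_gen \<alpha> \<tau> (Bullet (\<tau> a)) = \<one>\<^bsub>Lam \<alpha> \<tau>\<^esub>"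
proof -
  have one: "\<one>\<^bsub>Lam \<alpha> \<tau>\<^esub> = frag_of (pres_rel (Psi_gens \<alpha>) (Psi_relations \<alpha> \<tau>) `` {[]})"
    by (simp add: Lam_def group_ring_def Psi_def presented_group_def)
  have g: "Plain a \<in> Psi_gens \<alpha>" "Bullet a \<in> Psi_gens \<alpha>"
      "Plain (\<tau> a) \<in> Psi_gens \<alpha>" "Bullet (\<tau> a) \<in> Psi_gens \<alpha>"
    using assms by (auto simp: Psi_gens_def)
  show "lam_gen \<alpha> \<tau> (Plain a) \<otimes>\<^bsub>Lam \<alpha> \<tau>\<^esub> lam_gen \<alpha> \<tau> (Plain (\<tau> a)) = \<one>\<^bsub>Lam \<alpha> \<tau>\<^esub>"
    unfolding lam_gen_mult[OF g(1,3)] one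
    using assms g by (intro arg_cong[of _ _ frag_of] presented_relation) (auto simp: Psi_relations_def)
  show "lam_gen \<alpha> \<tau> (Bullet a) \<otimes>\<^bsub>Lam \<alpha> \<tau>\<^esub> lam_gen \<alpha> \<tau> (Bullet (\<tau> a)) = \<one>\<^bsub>Lam \<alpha> \<tau>\<^esub>"
    unfolding lam_gen_mult[OF g(2,4)] one
    using assms g by (intro arg_cong[of _ _ frag_of] presented_relation) (auto simp: Psi_relations_def)
qed

section \<open>Labellings of words\<close>

definition endpoint :: "'m \<Rightarrow> 'm list \<Rightarrow> 'm" where
  "endpoint p vs = last (p # vs)"

lemma endpoint_simps [simp]: "endpoint p [] = p" "endpoint p (q # vs) = endpoint q vs"
  by (auto simp: endpoint_def)

lemma endpoint_append [simp]: "endpoint p (vs @ us) = endpoint (endpoint p vs) us"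
  by (induction vs arbitrary: p) auto

lemma endpoint_map: "endpoint (h p) (map h vs) = h (endpoint p vs)"
  by (induction vs arbitrary: p) auto

lemma endpoint_closed: "p \<in> S \<Longrightarrow> set vs \<subseteq> S \<Longrightarrow> endpoint p vs \<in> S"
  by (induction vs arbitrary: p) auto

text \<open>
  The letters of a word together with the labels before and after them, where \<open>p\<close> is the label of the
  first gap and \<open>vs\<close> lists the labels of the other gaps, one for each letter. Splitting off the
  starting label makes \<open>edges\<close> compatible with concatenation of words. The last equation ends the
  recursion also when the lengths differ; labellings are required to have the length of the word.
\<close>

fun edges :: "'m \<Rightarrow> 'l list \<Rightarrow> 'm list \<Rightarrow> ('l \<times> 'm \<times> 'm) list" where
  "edges p (A # w) (q # vs) = (A, p, q) # edges q w vs"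
| "edges p w vs = []"

lemma edges_append [simp]:
  "length vs = length w \<Longrightarrow> edges p (w @ w') (vs @ vs') = edges p w vs @ edges (endpoint p vs) w' vs'"
  by (induction p w vs rule: edges.induct) auto

lemma length_edges [simp]: "length vs = length w \<Longrightarrow> length (edges p w vs) = length w"
  by (induction p w vs rule: edges.induct) auto

lemma nth_edges:
  "length vs = length w \<Longrightarrow> i < length w \<Longrightarrow> edges p w vs ! i = (w ! i, (p # vs) ! i, vs ! i)"
  by (induction p w vs arbitrary: i rule: edges.induct) (auto simp: nth_Cons split: nat.splits)

lemma edges_map: "edges (h p) (map f w) (map h vs) = map (\<lambda>(A, q, r). (f A, h q, h r)) (edges p w vs)"
  by (induction p w vs rule: edges.induct) auto

lemma edges_subset: "p \<in> S \<Longrightarrow> set vs \<subseteq> S \<Longrightarrow> set (edges p w vs) \<subseteq> set w \<times> S \<times> S"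
  by (induction p w vs rule: edges.induct) auto

text \<open>
  The equations of a letter, for its two occurrences in the order in which they appear in the word.
  For occurrences of different letters there is nothing to satisfy.
\<close>

definition compatible ::
    "'a set \<Rightarrow> ('a \<Rightarrow> 'a) \<Rightarrow> 'a set \<Rightarrow> ('a psi_gen gword set \<Rightarrow>\<^sub>0 int, 'm) module \<Rightarrow> ('l \<Rightarrow> 'a)
     \<Rightarrow> 'l \<times> 'm \<times> 'm \<Rightarrow> 'l \<times> 'm \<times> 'm \<Rightarrow> bool" where
  "compatible \<alpha> \<tau> \<beta> N pr = (\<lambda>(A, p, q) (B, r, s).
     let C = crossing (Lam \<alpha> \<tau>) N (lam_gen \<alpha> \<tau> (Plain (pr A))) (lam_gen \<alpha> \<tau> (Bullet (pr A)))
     in A = B \<longrightarrow> (if pr A \<in> \<beta> then C p q r s else C r s p q))"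

text \<open>
  \<^const>\<open>sorted_wrt\<close> relates each entry of a list to all later ones, so it visits the two occurrences
  of a letter once and in the right order.
\<close>

definition labelling ::
    "'a set \<Rightarrow> ('a \<Rightarrow> 'a) \<Rightarrow> 'a set \<Rightarrow> ('a psi_gen gword set \<Rightarrow>\<^sub>0 int, 'm) module \<Rightarrow> ('l, 'a) nanoword
     \<Rightarrow> 'm \<Rightarrow> 'm list \<Rightarrow> bool" where
  "labelling \<alpha> \<tau> \<beta> N W p vs \<longleftrightarrow>
     p \<in> carrier N \<and> set vs \<subseteq> carrier N \<and> length vs = length (word W) \<and>
     sorted_wrt (compatible \<alpha> \<tau> \<beta> N (proj W)) (edges p (word W) vs)"

lemma compatible_distinct: "A \<noteq> B \<Longrightarrow> compatible \<alpha> \<tau> \<beta> N pr (A, p, q) (B, r, s)"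
  by (simp add: compatible_def)

lemma crossing_lin_hom:
  assumes "left_module R M" and h: "h \<in> lin_hom R M N"
    and "a \<in> carrier R" "b \<in> carrier R" "p \<in> carrier M" "r \<in> carrier M"
    and "crossing R M a b p q r s"
  shows "crossing R N a b (h p) (h q) (h r) (h s)"
proof -
  interpret left_module R M by fact
  show ?thesis
    using assms by (simp add: crossing_def lin_hom_add lin_hom_smult)
qed

lemma labelling_lin_hom:
  assumes W: "is_nanoword \<alpha> W" and M: "left_module (Lam \<alpha> \<tau>) M" and h: "h \<in> lin_hom (Lam \<alpha> \<tau>) M N"
    and vs: "labelling \<alpha> \<tau> \<beta> M W p vs"
  shows "labelling \<alpha> \<tau> \<beta> N W (h p) (map h vs)"
proof -
  have E: "set (edges p (word W) vs) \<subseteq> letters W \<times> carrier M \<times> carrier M"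
    using edges_subset[of p "carrier M" vs "word W"] vs W
    by (auto simp: labelling_def is_nanoword_def)
  have pr: "proj W A \<in> \<alpha>" if "A \<in> letters W" for A
    using W that by (auto simp: is_nanoword_def)
  have "sorted_wrt (compatible \<alpha> \<tau> \<beta> N (proj W)) (map (\<lambda>(A, q, r). (id A, h q, h r)) (edges p (word W) vs))"
    unfolding sorted_wrt_map
  proof (rule sorted_wrt_mono_rel)
    show "sorted_wrt (compatible \<alpha> \<tau> \<beta> M (proj W)) (edges p (word W) vs)"
      using vs by (simp add: labelling_def)
    fix e f assume ef: "e \<in> set (edges p (word W) vs)" "f \<in> set (edges p (word W) vs)"
      "compatible \<alpha> \<tau> \<beta> M (proj W) e f"
    obtain A q r B s t where e: "e = (A, q, r)" and f: "f = (B, s, t)"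
      by (metis surj_pair)
    show "compatible \<alpha> \<tau> \<beta> N (proj W) (case e of (A, q, r) \<Rightarrow> (id A, h q, h r))
        (case f of (A, q, r) \<Rightarrow> (id A, h q, h r))"
      using ef E pr unfolding e f
      by (auto simp: compatible_def Let_def Plain_Bullet_carrier
          intro!: crossing_lin_hom[OF M h] split: if_splits)
  qed
  then show ?thesis
    using vs edges_map[of h p id "word W" vs] by (auto simp: labelling_def lin_hom_closed[OF h])
qed

lemma K_ambient_left_module: "left_module (Lam \<alpha> \<tau>) (K_ambient \<alpha> \<tau> W)"
  by (simp add: K_ambient_def free_module_left_module Lam_ring)

lemma K_basis_carrier: "K_basis \<alpha> \<tau> W k \<in> carrier (K_ambient \<alpha> \<tau> W)"
  by (simp add: K_basis_def K_ambient_def basis_vec_carrier Lam_ring)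

lemma K_letter_relators_subset:
  assumes "proj W A \<in> \<alpha>"
  shows "K_letter_relators \<alpha> \<tau> \<beta> W A i j \<subseteq> carrier (K_ambient \<alpha> \<tau> W)"
proof -
  interpret left_module "Lam \<alpha> \<tau>" "K_ambient \<alpha> \<tau> W" by (rule K_ambient_left_module)
  show ?thesis
    using Plain_Bullet_carrier[OF assms]
    by (auto simp: K_letter_relators_def Let_def K_basis_carrier)
qed

lemma K_relators_subset:
  assumes "is_nanoword \<alpha> W"
  shows "K_relators \<alpha> \<tau> \<beta> W \<subseteq> carrier (K_ambient \<alpha> \<tau> W)"
  using assms K_letter_relators_subset[of W _ \<alpha> \<tau> \<beta>]
  by (fastforce simp: K_relators_def is_nanoword_def)

lemma letter_relators_vanish_iff:
  assumes N: "left_module (Lam \<alpha> \<tau>) N" and \<phi>: "\<phi> \<in> lin_hom (Lam \<alpha> \<tau>) (K_ambient \<alpha> \<tau> W) N"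
    and pr: "proj W A \<in> \<alpha>"
  shows "(\<forall>x\<in>K_letter_relators \<alpha> \<tau> \<beta> W A (Suc i) (Suc j). \<phi> x = \<zero>\<^bsub>N\<^esub>) \<longleftrightarrow>
    compatible \<alpha> \<tau> \<beta> N (proj W) (A, \<phi> (K_basis \<alpha> \<tau> W i), \<phi> (K_basis \<alpha> \<tau> W (Suc i)))
      (A, \<phi> (K_basis \<alpha> \<tau> W j), \<phi> (K_basis \<alpha> \<tau> W (Suc j)))"
proof -
  interpret F: left_module "Lam \<alpha> \<tau>" "K_ambient \<alpha> \<tau> W" by (rule K_ambient_left_module)
  interpret N: left_module "Lam \<alpha> \<tau>" N by fact
  have swap: "u \<ominus>\<^bsub>N\<^esub> q \<oplus>\<^bsub>N\<^esub> w = (w \<oplus>\<^bsub>N\<^esub> u) \<ominus>\<^bsub>N\<^esub> q"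
    if "u \<in> carrier N" "q \<in> carrier N" "w \<in> carrier N" for u q w
    using that by (simp add: N.M.minus_eq N.M.a_ac)
  show ?thesis
    using Plain_Bullet_carrier[OF pr]
    by (auto simp: K_basis_carrier lin_hom_closed[OF \<phi>] K_letter_relators_def compatible_def crossing_def Let_def lin_hom_add[OF \<phi>]
        lin_hom_smult[OF \<phi>] lin_hom_minus[OF K_ambient_left_module N \<phi>] swap N.minus_eq_zero_iff)
qed

text \<open>
  The classes of the basis vectors except the first, in order: together with the input they form the
  universal labelling.
\<close>

definition K_labels ::
    "'a set \<Rightarrow> ('a \<Rightarrow> 'a) \<Rightarrow> 'a set \<Rightarrow> ('l, 'a) nanoword \<Rightarrow> 'a lam_vec set list" where
  "K_labels \<alpha> \<tau> \<beta> W =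
     map (\<lambda>k. K_submodule \<alpha> \<tau> \<beta> W +>\<^bsub>K_ambient \<alpha> \<tau> W\<^esub> K_basis \<alpha> \<tau> W k) [1..<Suc (length (word W))]"

lemma K_output_endpoint: "K_output \<alpha> \<tau> \<beta> W = endpoint (K_input \<alpha> \<tau> \<beta> W) (K_labels \<alpha> \<tau> \<beta> W)"
proof -
  have "K_input \<alpha> \<tau> \<beta> W # K_labels \<alpha> \<tau> \<beta> W =
      map (\<lambda>k. K_submodule \<alpha> \<tau> \<beta> W +>\<^bsub>K_ambient \<alpha> \<tau> W\<^esub> K_basis \<alpha> \<tau> W k) [0..<Suc (length (word W))]"
    by (simp add: K_input_def K_labels_def upt_conv_Cons del: upt_Suc)
  then show ?thesis
    unfolding endpoint_def by (simp only: upt_Suc_append[OF le0] map_append last_snoc list.map K_output_def)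
qed

text \<open>
  The translation between module presentations and labellings: a homomorphism on the free module
  factors through \<open>K\<^sub>\<beta>(W)\<close> if and only if the images of the basis vectors form a labelling.
\<close>

lemma relators_vanish_iff:
  assumes W: "is_nanoword \<alpha> W" and N: "left_module (Lam \<alpha> \<tau>) N"
    and \<phi>: "\<phi> \<in> lin_hom (Lam \<alpha> \<tau>) (K_ambient \<alpha> \<tau> W) N"
  shows "(\<forall>x\<in>K_relators \<alpha> \<tau> \<beta> W. \<phi> x = \<zero>\<^bsub>N\<^esub>) \<longleftrightarrow>
    labelling \<alpha> \<tau> \<beta> N W (\<phi> (K_basis \<alpha> \<tau> W 0))
      (map (\<lambda>k. \<phi> (K_basis \<alpha> \<tau> W k)) [1..<Suc (length (word W))])"
proof -
  define g where "g k = \<phi> (K_basis \<alpha> \<tau> W k)" for k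
  let ?w = "word W" and ?n = "length (word W)"
  define vs where "vs = map g [1..<Suc ?n]"
  have len: "length vs = ?n" by (simp add: vs_def del: upt_Suc)
  have nth: "vs ! i = g (Suc i)" "(g 0 # vs) ! i = g i" if "i < ?n" for i
    using that by (cases i; simp add: vs_def nth_append del: upt_Suc)+
  have pr: "proj W (?w ! i) \<in> \<alpha>" "?w ! i \<in> letters W" if "i < ?n" for i
    using W nth_mem[OF that] by (auto simp: is_nanoword_def)
  \<comment> \<open>List indices start at 0 and positions in the relators at 1: the letter with index \<open>i\<close> stands
    between the gaps \<open>i\<close> and \<open>i + 1\<close>.\<close>
  have pair: "compatible \<alpha> \<tau> \<beta> N (proj W) (?w ! i, g i, g (Suc i)) (?w ! j, g j, g (Suc j)) \<longleftrightarrow>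
      (?w ! i = ?w ! j \<longrightarrow>
       (\<forall>x\<in>K_letter_relators \<alpha> \<tau> \<beta> W (?w ! i) (Suc i) (Suc j). \<phi> x = \<zero>\<^bsub>N\<^esub>))" if "i < ?n" for i j
  proof (cases "?w ! i = ?w ! j")
    case True
    then show ?thesis
      using letter_relators_vanish_iff[OF N \<phi> pr(1)[OF that], of \<beta> i j] by (simp add: g_def)
  qed (simp add: compatible_distinct)
  have "sorted_wrt (compatible \<alpha> \<tau> \<beta> N (proj W)) (edges (g 0) ?w vs) \<longleftrightarrow>
    (\<forall>i j. i < j \<longrightarrow> j < ?n \<longrightarrow>
      compatible \<alpha> \<tau> \<beta> N (proj W) (?w ! i, g i, g (Suc i)) (?w ! j, g j, g (Suc j)))"
    by (auto simp: sorted_wrt_iff_nth_less len nth_edges nth)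
  also have "\<dots> \<longleftrightarrow> (\<forall>i j. i < j \<longrightarrow> j < ?n \<longrightarrow> ?w ! i = ?w ! j \<longrightarrow>
      (\<forall>x\<in>K_letter_relators \<alpha> \<tau> \<beta> W (?w ! i) (Suc i) (Suc j). \<phi> x = \<zero>\<^bsub>N\<^esub>))"
    using pair by (meson order.strict_trans)
  also have "\<dots> \<longleftrightarrow> (\<forall>x\<in>K_relators \<alpha> \<tau> \<beta> W. \<phi> x = \<zero>\<^bsub>N\<^esub>)"
  proof (intro iffI allI impI ballI)
    fix x assume *: "\<forall>i j. i < j \<longrightarrow> j < ?n \<longrightarrow> ?w ! i = ?w ! j \<longrightarrow>
      (\<forall>x\<in>K_letter_relators \<alpha> \<tau> \<beta> W (?w ! i) (Suc i) (Suc j). \<phi> x = \<zero>\<^bsub>N\<^esub>)"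
      and "x \<in> K_relators \<alpha> \<tau> \<beta> W"
    then obtain A i j where "1 \<le> i" "i < j" "j \<le> ?n" "?w ! (i - 1) = A" "?w ! (j - 1) = A"
      "x \<in> K_letter_relators \<alpha> \<tau> \<beta> W A i j"
      by (auto simp: K_relators_def)
    then show "\<phi> x = \<zero>\<^bsub>N\<^esub>"
      using *[rule_format, of "i - 1" "j - 1" x] by simp
  next
    fix i j x assume *: "\<forall>x\<in>K_relators \<alpha> \<tau> \<beta> W. \<phi> x = \<zero>\<^bsub>N\<^esub>" and ij: "i < j" "j < ?n" "?w ! i = ?w ! j"
      and x: "x \<in> K_letter_relators \<alpha> \<tau> \<beta> W (?w ! i) (Suc i) (Suc j)"
    have "K_letter_relators \<alpha> \<tau> \<beta> W (?w ! i) (Suc i) (Suc j) \<in>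
      {K_letter_relators \<alpha> \<tau> \<beta> W A i j | A i j. A \<in> letters W \<and> 1 \<le> i \<and> i < j \<and> j \<le> ?n \<and>
        ?w ! (i - 1) = A \<and> ?w ! (j - 1) = A}"
      using ij pr(2)[of i] by (intro CollectI exI[of _ "?w ! i"] exI[of _ "Suc i"] exI[of _ "Suc j"]) auto
    then have "x \<in> K_relators \<alpha> \<tau> \<beta> W"
      unfolding K_relators_def using x by (rule UnionI)
    then show "\<phi> x = \<zero>\<^bsub>N\<^esub>" using * by blast
  qed
  finally have "sorted_wrt (compatible \<alpha> \<tau> \<beta> N (proj W)) (edges (g 0) ?w vs) \<longleftrightarrow>
      (\<forall>x\<in>K_relators \<alpha> \<tau> \<beta> W. \<phi> x = \<zero>\<^bsub>N\<^esub>)" .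
  moreover have "g k \<in> carrier N" for k
    by (simp add: g_def lin_hom_closed[OF \<phi>] K_basis_carrier)
  then have "set vs \<subseteq> carrier N" "g 0 \<in> carrier N"
    by (auto simp: vs_def)
  ultimately show ?thesis
    using len unfolding labelling_def g_def[symmetric] vs_def[symmetric] by simp
qed

context
  fixes \<alpha> :: "'a set" and \<tau> :: "'a \<Rightarrow> 'a" and \<beta> :: "'a set" and W :: "('l, 'a) nanoword"
  assumes W: "is_nanoword \<alpha> W"
begin

lemma K_submodule_submodule: "submodule (K_submodule \<alpha> \<tau> \<beta> W) (Lam \<alpha> \<tau>) (K_ambient \<alpha> \<tau> W)"
  unfolding K_submodule_def
  by (intro left_module.span_submodule_is_submodule K_ambient_left_module K_relators_subset W)

lemma labelling_generic:
  "labelling \<alpha> \<tau> \<beta> (K_module \<alpha> \<tau> \<beta> W) W (K_input \<alpha> \<tau> \<beta> W) (K_labels \<alpha> \<tau> \<beta> W)"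
proof -
  let ?F = "K_ambient \<alpha> \<tau> W" and ?N = "K_submodule \<alpha> \<tau> \<beta> W"
  interpret F: left_module "Lam \<alpha> \<tau>" ?F by (rule K_ambient_left_module)
  interpret N: submodule ?N "Lam \<alpha> \<tau>" ?F by (rule K_submodule_submodule)
  have "?N +>\<^bsub>?F\<^esub> x = \<zero>\<^bsub>K_module \<alpha> \<tau> \<beta> W\<^esub>" if "x \<in> K_relators \<alpha> \<tau> \<beta> W" for x
  proof -
    have "x \<in> ?N"
      unfolding K_submodule_def span_submodule_def by (rule subsetD[OF hull_subset that])
    then show ?thesis
      using N.subset F.M.a_coset_join2[of x ?N] N.subgroup_axioms
      by (auto simp: K_module_def quotient_module_def)
  qed
  then show ?thesis
    using relators_vanish_iff[OF W K_module_left_module[OF W]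
        quotient_projection[OF K_ambient_left_module K_submodule_submodule, folded K_module_def],
        of \<beta>]
    by (simp add: K_input_def K_labels_def del: upt_Suc)
qed

lemma K_module_universal:
  assumes N: "left_module (Lam \<alpha> \<tau>) N" and vs: "labelling \<alpha> \<tau> \<beta> N W p vs"
  obtains h where "h \<in> lin_hom (Lam \<alpha> \<tau>) (K_module \<alpha> \<tau> \<beta> W) N"
    "h (K_input \<alpha> \<tau> \<beta> W) = p" "map h (K_labels \<alpha> \<tau> \<beta> W) = vs"
proof -
  let ?F = "K_ambient \<alpha> \<tau> W" and ?n = "length (word W)"
  have len: "length vs = ?n" and carr: "p \<in> carrier N" "set vs \<subseteq> carrier N"
    using vs by (auto simp: labelling_def)
  have "(p # vs) ! k \<in> carrier N" if "k \<in> {0..?n}" for k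
    using that len carr nth_mem[of k "p # vs"] by auto
  then obtain \<phi> where \<phi>: "\<phi> \<in> lin_hom (Lam \<alpha> \<tau>) ?F N"
    and b: "\<And>k. k \<in> {0..?n} \<Longrightarrow> \<phi> (K_basis \<alpha> \<tau> W k) = (p # vs) ! k"
    unfolding K_ambient_def K_basis_def
    using free_module_extend[OF N, of "{0..?n}" "\<lambda>k. (p # vs) ! k"] by blast
  have bs: "map (\<lambda>k. \<phi> (K_basis \<alpha> \<tau> W k)) [1..<Suc ?n] = vs"
    using len by (intro nth_equalityI) (auto simp: b simp del: upt_Suc)
  have "\<forall>x\<in>K_relators \<alpha> \<tau> \<beta> W. \<phi> x = \<zero>\<^bsub>N\<^esub>"
    unfolding relators_vanish_iff[OF W N \<phi>] bs using vs b[of 0] by simp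
  then obtain h where h: "h \<in> lin_hom (Lam \<alpha> \<tau>) (K_module \<alpha> \<tau> \<beta> W) N"
    and hb: "\<And>x. x \<in> carrier ?F \<Longrightarrow> h (K_submodule \<alpha> \<tau> \<beta> W +>\<^bsub>?F\<^esub> x) = \<phi> x"
    using presented_module_lift[OF N K_relators_subset[OF W, unfolded K_ambient_def]
        \<phi>[unfolded K_ambient_def]]
    unfolding K_module_def K_submodule_def K_ambient_def by metis
  show ?thesis
  proof
    show "h (K_input \<alpha> \<tau> \<beta> W) = p"
      using hb[OF K_basis_carrier, of 0] b[of 0] by (simp add: K_input_def)
    show "map h (K_labels \<alpha> \<tau> \<beta> W) = vs"
      unfolding K_labels_def bs[symmetric] by (simp add: hb K_basis_carrier)
  qed (rule h)
qed

lemma K_module_hom_eqI: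
  assumes N: "left_module (Lam \<alpha> \<tau>) N"
    and h: "h \<in> lin_hom (Lam \<alpha> \<tau>) (K_module \<alpha> \<tau> \<beta> W) N" and k: "k \<in> lin_hom (Lam \<alpha> \<tau>) (K_module \<alpha> \<tau> \<beta> W) N"
    and input: "h (K_input \<alpha> \<tau> \<beta> W) = k (K_input \<alpha> \<tau> \<beta> W)"
    and labels: "map h (K_labels \<alpha> \<tau> \<beta> W) = map k (K_labels \<alpha> \<tau> \<beta> W)"
    and x: "x \<in> carrier (K_module \<alpha> \<tau> \<beta> W)"
  shows "h x = k x"
proof -
  have "h (K_submodule \<alpha> \<tau> \<beta> W +>\<^bsub>K_ambient \<alpha> \<tau> W\<^esub> K_basis \<alpha> \<tau> W i) =
      k (K_submodule \<alpha> \<tau> \<beta> W +>\<^bsub>K_ambient \<alpha> \<tau> W\<^esub> K_basis \<alpha> \<tau> W i)" if "i \<in> {0..length (word W)}" for i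
    using that input labels by (cases "i = 0") (auto simp: K_input_def K_labels_def simp del: upt_Suc)
  then show ?thesis
    using presented_module_hom_eqI[OF N _ K_submodule_submodule[unfolded K_ambient_def], of "h" k x] h k x
    unfolding K_module_def K_ambient_def K_basis_def by simp
qed

end

text \<open>
  Isomorphism of the triples, given by a pair of inverse homomorphisms so that symmetry and
  transitivity are immediate.
\<close>

definition K_isomorphic ::
    "'a set \<Rightarrow> ('a \<Rightarrow> 'a) \<Rightarrow> 'a set \<Rightarrow> ('l, 'a) nanoword \<Rightarrow> ('l, 'a) nanoword \<Rightarrow> bool" where
  "K_isomorphic \<alpha> \<tau> \<beta> W W' \<longleftrightarrow>
     (\<exists>h \<in> lin_hom (Lam \<alpha> \<tau>) (K_module \<alpha> \<tau> \<beta> W) (K_module \<alpha> \<tau> \<beta> W').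
      \<exists>k \<in> lin_hom (Lam \<alpha> \<tau>) (K_module \<alpha> \<tau> \<beta> W') (K_module \<alpha> \<tau> \<beta> W).
        (\<forall>x \<in> carrier (K_module \<alpha> \<tau> \<beta> W). k (h x) = x) \<and>
        (\<forall>y \<in> carrier (K_module \<alpha> \<tau> \<beta> W'). h (k y) = y) \<and>
        h (K_input \<alpha> \<tau> \<beta> W) = K_input \<alpha> \<tau> \<beta> W' \<and> k (K_input \<alpha> \<tau> \<beta> W') = K_input \<alpha> \<tau> \<beta> W \<and>
        h (K_output \<alpha> \<tau> \<beta> W) = K_output \<alpha> \<tau> \<beta> W' \<and> k (K_output \<alpha> \<tau> \<beta> W') = K_output \<alpha> \<tau> \<beta> W)"

lemma K_isomorphic_refl: "K_isomorphic \<alpha> \<tau> \<beta> W W"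
  unfolding K_isomorphic_def by (rule bexI[where x = "\<lambda>x. x"], rule bexI[where x = "\<lambda>x. x"]) (simp_all add: lin_hom_id)

lemma K_isomorphic_sym: "K_isomorphic \<alpha> \<tau> \<beta> W W' \<Longrightarrow> K_isomorphic \<alpha> \<tau> \<beta> W' W"
  unfolding K_isomorphic_def by blast

lemma K_isomorphic_trans:
  assumes "K_isomorphic \<alpha> \<tau> \<beta> W W'" "K_isomorphic \<alpha> \<tau> \<beta> W' W''"
  shows "K_isomorphic \<alpha> \<tau> \<beta> W W''"
proof -
  obtain h k where h: "h \<in> lin_hom (Lam \<alpha> \<tau>) (K_module \<alpha> \<tau> \<beta> W) (K_module \<alpha> \<tau> \<beta> W')"
    and k: "k \<in> lin_hom (Lam \<alpha> \<tau>) (K_module \<alpha> \<tau> \<beta> W') (K_module \<alpha> \<tau> \<beta> W)"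
    and hk: "\<And>x. x \<in> carrier (K_module \<alpha> \<tau> \<beta> W) \<Longrightarrow> k (h x) = x"
      "\<And>x. x \<in> carrier (K_module \<alpha> \<tau> \<beta> W') \<Longrightarrow> h (k x) = x"
      "h (K_input \<alpha> \<tau> \<beta> W) = K_input \<alpha> \<tau> \<beta> W'" "k (K_input \<alpha> \<tau> \<beta> W') = K_input \<alpha> \<tau> \<beta> W"
      "h (K_output \<alpha> \<tau> \<beta> W) = K_output \<alpha> \<tau> \<beta> W'" "k (K_output \<alpha> \<tau> \<beta> W') = K_output \<alpha> \<tau> \<beta> W"
    using assms(1) unfolding K_isomorphic_def by auto
  obtain h' k' where h': "h' \<in> lin_hom (Lam \<alpha> \<tau>) (K_module \<alpha> \<tau> \<beta> W') (K_module \<alpha> \<tau> \<beta> W'')"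
    and k': "k' \<in> lin_hom (Lam \<alpha> \<tau>) (K_module \<alpha> \<tau> \<beta> W'') (K_module \<alpha> \<tau> \<beta> W')"
    and hk': "\<And>x. x \<in> carrier (K_module \<alpha> \<tau> \<beta> W') \<Longrightarrow> k' (h' x) = x"
      "\<And>x. x \<in> carrier (K_module \<alpha> \<tau> \<beta> W'') \<Longrightarrow> h' (k' x) = x"
      "h' (K_input \<alpha> \<tau> \<beta> W') = K_input \<alpha> \<tau> \<beta> W''" "k' (K_input \<alpha> \<tau> \<beta> W'') = K_input \<alpha> \<tau> \<beta> W'"
      "h' (K_output \<alpha> \<tau> \<beta> W') = K_output \<alpha> \<tau> \<beta> W''" "k' (K_output \<alpha> \<tau> \<beta> W'') = K_output \<alpha> \<tau> \<beta> W'"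
    using assms(2) unfolding K_isomorphic_def by auto
  show ?thesis
    unfolding K_isomorphic_def
    by (rule bexI[where x = "\<lambda>x. h' (h x)"], rule bexI[where x = "\<lambda>x. k (k' x)"])
      (simp_all add: hk hk' lin_hom_closed[OF h] lin_hom_closed[OF k'] lin_hom_compose[OF h h']
        lin_hom_compose[OF k' k])
qed

text \<open>
  The relation \<open>T\<close> says which labellings of \<open>W\<close> and \<open>W'\<close> correspond. The labelling of \<open>W'\<close> that
  corresponds to the universal labelling of \<open>W\<close> defines a homomorphism \<open>k\<close> from \<open>K\<^sub>\<beta>(W')\<close> to
  \<open>K\<^sub>\<beta>(W)\<close>, and exchanging the words gives \<open>h\<close> in the other direction. By naturality, \<open>k \<circ> h\<close> sends
  the universal labelling of \<open>W\<close> to one that corresponds to the same labelling of \<open>W'\<close> as the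
  universal labelling itself, so by uniqueness it fixes it and is the identity.
\<close>

lemma K_isomorphic_by_relabelling:
  fixes W W' :: "('l, 'a) nanoword" and T :: "'a lam_vec set list \<Rightarrow> 'a lam_vec set list \<Rightarrow> bool"
  assumes W: "is_nanoword \<alpha> W" and W': "is_nanoword \<alpha> W'"
    and fwd: "\<And>N :: ('a psi_gen gword set \<Rightarrow>\<^sub>0 int, 'a lam_vec set) module. \<And>p vs.
      left_module (Lam \<alpha> \<tau>) N \<Longrightarrow> labelling \<alpha> \<tau> \<beta> N W p vs \<Longrightarrow>
      \<exists>!vs'. labelling \<alpha> \<tau> \<beta> N W' p vs' \<and> endpoint p vs' = endpoint p vs \<and> T vs vs'"
    and bwd: "\<And>N :: ('a psi_gen gword set \<Rightarrow>\<^sub>0 int, 'a lam_vec set) module. \<And>p vs'.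
      left_module (Lam \<alpha> \<tau>) N \<Longrightarrow> labelling \<alpha> \<tau> \<beta> N W' p vs' \<Longrightarrow>
      \<exists>!vs. labelling \<alpha> \<tau> \<beta> N W p vs \<and> endpoint p vs' = endpoint p vs \<and> T vs vs'"
    and nat: "\<And>h vs vs'. T vs vs' \<Longrightarrow> T (map h vs) (map h vs')"
  shows "K_isomorphic \<alpha> \<tau> \<beta> W W'"
proof -
  let ?K = "K_module \<alpha> \<tau> \<beta> W" and ?K' = "K_module \<alpha> \<tau> \<beta> W'"
  let ?i = "K_input \<alpha> \<tau> \<beta> W" and ?i' = "K_input \<alpha> \<tau> \<beta> W'"
  let ?g = "K_labels \<alpha> \<tau> \<beta> W" and ?g' = "K_labels \<alpha> \<tau> \<beta> W'"
  note K = K_module_left_module[OF W] and K' = K_module_left_module[OF W']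
  obtain u' where u': "labelling \<alpha> \<tau> \<beta> ?K W' ?i u'" "endpoint ?i u' = endpoint ?i ?g" "T ?g u'"
    using fwd[OF K labelling_generic[OF W]] by blast
  obtain u where u: "labelling \<alpha> \<tau> \<beta> ?K' W ?i' u" "endpoint ?i' ?g' = endpoint ?i' u" "T u ?g'"
    using bwd[OF K' labelling_generic[OF W']] by blast
  obtain h where h: "h \<in> lin_hom (Lam \<alpha> \<tau>) ?K ?K'" "h ?i = ?i'" "map h ?g = u"
    by (rule K_module_universal[OF W K' u(1)])
  obtain k where k: "k \<in> lin_hom (Lam \<alpha> \<tau>) ?K' ?K" "k ?i' = ?i" "map k ?g' = u'"
    by (rule K_module_universal[OF W' K u'(1)])
  have hk: "h (K_output \<alpha> \<tau> \<beta> W) = K_output \<alpha> \<tau> \<beta> W'" "k (K_output \<alpha> \<tau> \<beta> W') = K_output \<alpha> \<tau> \<beta> W"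
    unfolding K_output_endpoint by (metis endpoint_map h(2,3) u(2) k(2,3) u'(2))+
  have ku: "map k u = ?g"
  proof -
    have "labelling \<alpha> \<tau> \<beta> ?K W ?i (map k u)"
      using labelling_lin_hom[OF W K' k(1) u(1)] by (simp add: k)
    moreover have "endpoint ?i u' = endpoint ?i (map k u)"
      using endpoint_map[of k ?i' u] endpoint_map[of k ?i' ?g'] u(2) by (simp add: k)
    moreover have "T (map k u) u'"
      using nat[OF u(3), of k] by (simp add: k)
    ultimately show ?thesis
      using bwd[OF K u'(1)] labelling_generic[OF W] u'(2,3) by blast
  qed
  have hu: "map h u' = ?g'"
  proof -
    have "labelling \<alpha> \<tau> \<beta> ?K' W' ?i' (map h u')"
      using labelling_lin_hom[OF W' K h(1) u'(1)] by (simp add: h)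
    moreover have "endpoint ?i' (map h u') = endpoint ?i' u"
      using endpoint_map[of h ?i u'] endpoint_map[of h ?i ?g] u'(2) by (simp add: h)
    moreover have "T u (map h u')"
      using nat[OF u'(3), of h] by (simp add: h)
    ultimately show ?thesis
      using fwd[OF K' u(1)] labelling_generic[OF W'] u(2,3) by blast
  qed
  have "k (h x) = x" if "x \<in> carrier ?K" for x
  proof (rule K_module_hom_eqI[OF W K lin_hom_compose[OF h(1) k(1)] lin_hom_id _ _ that])
    show "map (\<lambda>x. k (h x)) ?g = map (\<lambda>x. x) ?g"
      using ku unfolding h(3)[symmetric] by (simp add: comp_def)
  qed (simp only: h k)
  moreover have "h (k x) = x" if "x \<in> carrier ?K'" for x
  proof (rule K_module_hom_eqI[OF W' K' lin_hom_compose[OF k(1) h(1)] lin_hom_id _ _ that])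
    show "map (\<lambda>x. h (k x)) ?g' = map (\<lambda>x. x) ?g'"
      using hu unfolding k(3)[symmetric] by (simp add: comp_def)
  qed (simp only: h k)
  ultimately show ?thesis
    unfolding K_isomorphic_def using h k hk by blast
qed

section \<open>The local systems of the homotopy moves\<close>

text \<open>
  The following three lemmas state the solution of the linear systems in a form that does not depend
  on whether the letters lie in \<open>\<beta>\<close>. Only the existence of the solution matters afterwards, so its
  formula is hidden behind functions of the labels that enter the blocks.
\<close>

lemma kink_compatible:
  assumes N: "left_module (Lam \<alpha> \<tau>) N" and a: "pr A \<in> \<alpha>" "\<tau> (pr A) \<in> \<alpha>" "\<tau> (\<tau> (pr A)) = pr A"
  obtains f where "\<And>u. u \<in> carrier N \<Longrightarrow> f u \<in> carrier N"
    "\<And>u q r. \<lbrakk>u \<in> carrier N; q \<in> carrier N; r \<in> carrier N\<rbrakk> \<Longrightarrow>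
      sorted_wrt (compatible \<alpha> \<tau> \<beta> N pr) [(A, u, q), (A, q, r)] \<longleftrightarrow> q = f u \<and> r = u"
proof -
  interpret left_module "Lam \<alpha> \<tau>" N by fact
  note c = Plain_Bullet_carrier[OF a(1), of \<tau>] and comm = Plain_Bullet_commute[OF a(1), of \<tau>]
    and c' = Plain_Bullet_carrier[OF a(2), of \<tau>]
    and i = Plain_Bullet_inverse[of "pr A" \<alpha> \<tau>, OF a(1,2)] and i' = Plain_Bullet_inverse[of "\<tau> (pr A)" \<alpha> \<tau>, unfolded a(3), OF a(2,1)]
  show ?thesis
  proof (cases "pr A \<in> \<beta>")
    case True
    then show ?thesis
      using crossing_kink[OF c comm] c
      by (intro that[of "\<lambda>u. lam_gen \<alpha> \<tau> (Plain (pr A)) \<odot>\<^bsub>N\<^esub> u"]) (auto simp: compatible_def)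
  next
    case False
    then show ?thesis
      using crossing_kink_exchanged[OF c comm c'(1) i'(1) i(1) c'(2) i'(2)] c'
      by (intro that[of "\<lambda>u. lam_gen \<alpha> \<tau> (Plain (\<tau> (pr A))) \<odot>\<^bsub>N\<^esub> u"]) (auto simp: compatible_def)
  qed
qed

lemma cancelling_pair_compatible:
  assumes N: "left_module (Lam \<alpha> \<tau>) N" and \<beta>: "\<tau> ` \<beta> = \<beta>" 
    and A: "pr A \<in> \<alpha>" and B: "pr B \<in> \<alpha>" "\<tau> (\<tau> (pr B)) = pr B"
    and AB: "A \<noteq> B" "pr A = \<tau> (pr B)"
  obtains f g where "\<And>u v. u \<in> carrier N \<Longrightarrow> v \<in> carrier N \<Longrightarrow> f u v \<in> carrier N"
    "\<And>u v. u \<in> carrier N \<Longrightarrow> v \<in> carrier N \<Longrightarrow> g u v \<in> carrier N"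
    "\<And>u v q r s t. \<lbrakk>u \<in> carrier N; v \<in> carrier N; q \<in> carrier N; r \<in> carrier N; s \<in> carrier N; t \<in> carrier N\<rbrakk> \<Longrightarrow>
      sorted_wrt (compatible \<alpha> \<tau> \<beta> N pr) [(A, u, q), (B, q, r), (B, v, s), (A, s, t)] \<longleftrightarrow>
      r = u \<and> t = v \<and> q = f u v \<and> s = g u v"
proof -
  interpret left_module "Lam \<alpha> \<tau>" N by fact
  have BA: "\<tau> (pr A) = pr B" using AB B by simp
  have same: "pr A \<in> \<beta> \<longleftrightarrow> pr B \<in> \<beta>"
    using \<beta> BA AB(2) by (metis imageI)
  note cA = Plain_Bullet_carrier[OF A, of \<tau>] and commA = Plain_Bullet_commute[OF A, of \<tau>]
    and cB = Plain_Bullet_carrier[OF B(1), of \<tau>] and commB = Plain_Bullet_commute[OF B(1), of \<tau>]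
    and iA = Plain_Bullet_inverse[of "pr A" \<alpha> \<tau>, unfolded BA, OF A B(1)]
    and iB = Plain_Bullet_inverse[of "pr B" \<alpha> \<tau>, folded AB(2), OF B(1) A]
  show ?thesis
  proof (cases "pr A \<in> \<beta>")
    case True
    then show ?thesis
      using crossing_cancelling_pair[OF cA commA cB(1) iB(1) cB(2) iA(2) iB(2) commB] AB(1) same cA cB
      by (intro that[of "\<lambda>u v. lam_gen \<alpha> \<tau> (Plain (pr A)) \<odot>\<^bsub>N\<^esub> u"
        "\<lambda>u v. (\<one>\<^bsub>Lam \<alpha> \<tau>\<^esub> \<ominus>\<^bsub>Lam \<alpha> \<tau>\<^esub> lam_gen \<alpha> \<tau> (Plain (pr B)) \<otimes>\<^bsub>Lam \<alpha> \<tau>\<^esub> lam_gen \<alpha> \<tau> (Bullet (pr B)))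
            \<odot>\<^bsub>N\<^esub> (lam_gen \<alpha> \<tau> (Plain (pr A)) \<odot>\<^bsub>N\<^esub> u) \<oplus>\<^bsub>N\<^esub> lam_gen \<alpha> \<tau> (Bullet (pr B)) \<odot>\<^bsub>N\<^esub> v"])
        (simp_all add: compatible_def)
  next
    case False
    \<comment> \<open>Exchanging the occurrences of both letters gives the same system with \<open>A\<close> and \<open>B\<close> swapped and
      the second block before the first.\<close>
    have "crossing (Lam \<alpha> \<tau>) N (lam_gen \<alpha> \<tau> (Plain (pr A))) (lam_gen \<alpha> \<tau> (Bullet (pr A))) s t u q \<and>
        crossing (Lam \<alpha> \<tau>) N (lam_gen \<alpha> \<tau> (Plain (pr B))) (lam_gen \<alpha> \<tau> (Bullet (pr B))) v s q r \<longleftrightarrow>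
      r = u \<and> t = v \<and> 
      q = (\<one>\<^bsub>Lam \<alpha> \<tau>\<^esub> \<ominus>\<^bsub>Lam \<alpha> \<tau>\<^esub> lam_gen \<alpha> \<tau> (Plain (pr A)) \<otimes>\<^bsub>Lam \<alpha> \<tau>\<^esub> lam_gen \<alpha> \<tau> (Bullet (pr A)))
            \<odot>\<^bsub>N\<^esub> (lam_gen \<alpha> \<tau> (Plain (pr B)) \<odot>\<^bsub>N\<^esub> v) \<oplus>\<^bsub>N\<^esub> lam_gen \<alpha> \<tau> (Bullet (pr A)) \<odot>\<^bsub>N\<^esub> u \<and>
      s = lam_gen \<alpha> \<tau> (Plain (pr B)) \<odot>\<^bsub>N\<^esub> v"
      if "u \<in> carrier N" "v \<in> carrier N" "q \<in> carrier N" "r \<in> carrier N" "s \<in> carrier N" "t \<in> carrier N"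
      for u v q r s t
      using crossing_cancelling_pair[OF cB commB cA(1) iA(1) cA(2) iB(2) iA(2) commA, of v s t u q r] that
      by blast
    then show ?thesis
      using AB(1) same cA cB False
      by (intro that[of "\<lambda>u v. (\<one>\<^bsub>Lam \<alpha> \<tau>\<^esub> \<ominus>\<^bsub>Lam \<alpha> \<tau>\<^esub> lam_gen \<alpha> \<tau> (Plain (pr A)) \<otimes>\<^bsub>Lam \<alpha> \<tau>\<^esub> lam_gen \<alpha> \<tau> (Bullet (pr A)))
            \<odot>\<^bsub>N\<^esub> (lam_gen \<alpha> \<tau> (Plain (pr B)) \<odot>\<^bsub>N\<^esub> v) \<oplus>\<^bsub>N\<^esub> lam_gen \<alpha> \<tau> (Bullet (pr A)) \<odot>\<^bsub>N\<^esub> u"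
            "\<lambda>u v. lam_gen \<alpha> \<tau> (Plain (pr B)) \<odot>\<^bsub>N\<^esub> v"])
        (simp_all add: compatible_def)
  qed
qed

text \<open>
  \<open>Z\<close> is the relation between entering and leaving labels, common to both sides of the move.
\<close>

lemma triangle_compatible:
  assumes N: "left_module (Lam \<alpha> \<tau>) N" and pr: "pr A \<in> \<alpha>" "pr A = pr B" "pr B = pr C"
    and dist: "distinct [A, B, C]"
  obtains F G :: "'m \<Rightarrow> 'm \<Rightarrow> 'm \<Rightarrow> 'm \<times> 'm \<times> 'm" and Z
  where "\<And>p1 p2 p3. \<lbrakk>p1 \<in> carrier N; p2 \<in> carrier N; p3 \<in> carrier N\<rbrakk> \<Longrightarrow>
      F p1 p2 p3 \<in> carrier N \<times> carrier N \<times> carrier N"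
    "\<And>p1 p2 p3. \<lbrakk>p1 \<in> carrier N; p2 \<in> carrier N; p3 \<in> carrier N\<rbrakk> \<Longrightarrow>
      G p1 p2 p3 \<in> carrier N \<times> carrier N \<times> carrier N"
    "\<And>p1 p2 p3 q1 q2 q3 r1 r2 r3. {p1, p2, p3, q1, q2, q3, r1, r2, r3} \<subseteq> carrier N \<Longrightarrow>
      sorted_wrt (compatible \<alpha> \<tau> \<beta> N pr)
        [(A, p1, q1), (B, q1, r1), (A, p2, q2), (C, q2, r2), (B, p3, q3), (C, q3, r3)] \<longleftrightarrow>
      (q1, q2, q3) = F p1 p2 p3 \<and> Z p1 p2 p3 r1 r2 r3"
    "\<And>p1 p2 p3 q1 q2 q3 r1 r2 r3. {p1, p2, p3, q1, q2, q3, r1, r2, r3} \<subseteq> carrier N \<Longrightarrow>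
      sorted_wrt (compatible \<alpha> \<tau> \<beta> N pr)
        [(B, p1, q1), (A, q1, r1), (C, p2, q2), (A, q2, r2), (C, p3, q3), (B, q3, r3)] \<longleftrightarrow>
      (q1, q2, q3) = G p1 p2 p3 \<and> Z p1 p2 p3 r1 r2 r3"
proof -
  interpret left_module "Lam \<alpha> \<tau>" N by fact
  define a where "a = lam_gen \<alpha> \<tau> (Plain (pr A))"
  define b where "b = lam_gen \<alpha> \<tau> (Bullet (pr A))"
  define c where "c = \<one>\<^bsub>Lam \<alpha> \<tau>\<^esub> \<ominus>\<^bsub>Lam \<alpha> \<tau>\<^esub> a \<otimes>\<^bsub>Lam \<alpha> \<tau>\<^esub> b"
  define F where "F p1 p2 p3 = (a \<odot>\<^bsub>N\<^esub> p1, c \<odot>\<^bsub>N\<^esub> p1 \<oplus>\<^bsub>N\<^esub> b \<odot>\<^bsub>N\<^esub> p2,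
      c \<odot>\<^bsub>N\<^esub> (a \<odot>\<^bsub>N\<^esub> p1) \<oplus>\<^bsub>N\<^esub> b \<odot>\<^bsub>N\<^esub> p3)" for p1 p2 p3
  define G where "G p1 p2 p3 = (a \<odot>\<^bsub>N\<^esub> p1, a \<odot>\<^bsub>N\<^esub> p2, c \<odot>\<^bsub>N\<^esub> p2 \<oplus>\<^bsub>N\<^esub> b \<odot>\<^bsub>N\<^esub> p3)" for p1 p2 p3
  define Z where "Z p1 p2 p3 r1 r2 r3 \<longleftrightarrow> r1 = a \<odot>\<^bsub>N\<^esub> (a \<odot>\<^bsub>N\<^esub> p1) \<and>
      r2 = c \<odot>\<^bsub>N\<^esub> (a \<odot>\<^bsub>N\<^esub> p1) \<oplus>\<^bsub>N\<^esub> b \<odot>\<^bsub>N\<^esub> (a \<odot>\<^bsub>N\<^esub> p2) \<and>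
      r3 = c \<odot>\<^bsub>N\<^esub> p1 \<oplus>\<^bsub>N\<^esub> b \<odot>\<^bsub>N\<^esub> (c \<odot>\<^bsub>N\<^esub> p2 \<oplus>\<^bsub>N\<^esub> b \<odot>\<^bsub>N\<^esub> p3)" for p1 p2 p3 r1 r2 r3
  have ab: "a \<in> carrier (Lam \<alpha> \<tau>)" "b \<in> carrier (Lam \<alpha> \<tau>)" "a \<otimes>\<^bsub>Lam \<alpha> \<tau>\<^esub> b = b \<otimes>\<^bsub>Lam \<alpha> \<tau>\<^esub> a"
    using Plain_Bullet_carrier[OF pr(1)] Plain_Bullet_commute[OF pr(1)] by (auto simp: a_def b_def)
  have c: "c \<in> carrier (Lam \<alpha> \<tau>)" using ab(1,2) by (simp add: c_def)
  let ?X = "crossing (Lam \<alpha> \<tau>) N a b"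
  have tri: "?X p1 q1 p2 q2 \<and> ?X q1 r1 p3 q3 \<and> ?X q2 r2 q3 r3 \<longleftrightarrow>
        (q1, q2, q3) = F p1 p2 p3 \<and> Z p1 p2 p3 r1 r2 r3"
      "?X p1 q1 q3 r3 \<and> ?X q1 r1 q2 r2 \<and> ?X p2 q2 p3 q3 \<longleftrightarrow>
        (q1, q2, q3) = G p1 p2 p3 \<and> Z p1 p2 p3 r1 r2 r3"
    if "{p1, p2, p3, q1, q2, q3, r1, r2, r3} \<subseteq> carrier N" for p1 p2 p3 q1 q2 q3 r1 r2 r3
    using crossing_triangle[OF ab, of p1 p2 p3 q1 q2 q3 r1 r2 r3] that
    unfolding F_def G_def Z_def c_def by auto
  have closed: "F p1 p2 p3 \<in> carrier N \<times> carrier N \<times> carrier N"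
      "G p1 p2 p3 \<in> carrier N \<times> carrier N \<times> carrier N"
    if "p1 \<in> carrier N" "p2 \<in> carrier N" "p3 \<in> carrier N" for p1 p2 p3
    using that ab(1,2) c by (auto simp: F_def G_def)
  note comp = compatible_def Let_def pr(2,3)[symmetric] a_def[symmetric] b_def[symmetric]
  show ?thesis
  proof (cases "pr A \<in> \<beta>")
    case True
    show ?thesis
    proof (rule that[of F G Z])
      fix p1 p2 p3 q1 q2 q3 r1 r2 r3 assume carr: "{p1, p2, p3, q1, q2, q3, r1, r2, r3} \<subseteq> carrier N"
      show "sorted_wrt (compatible \<alpha> \<tau> \<beta> N pr)
          [(A, p1, q1), (B, q1, r1), (A, p2, q2), (C, q2, r2), (B, p3, q3), (C, q3, r3)] \<longleftrightarrow>
        (q1, q2, q3) = F p1 p2 p3 \<and> Z p1 p2 p3 r1 r2 r3"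
        unfolding tri(1)[OF carr, symmetric] using True dist by (auto simp: comp)
      show "sorted_wrt (compatible \<alpha> \<tau> \<beta> N pr)
          [(B, p1, q1), (A, q1, r1), (C, p2, q2), (A, q2, r2), (C, p3, q3), (B, q3, r3)] \<longleftrightarrow>
        (q1, q2, q3) = G p1 p2 p3 \<and> Z p1 p2 p3 r1 r2 r3"
        unfolding tri(2)[OF carr, symmetric] using True dist by (auto simp: comp)
    qed (use closed in auto)
  next
    case False
    \<comment> \<open>Exchanging the occurrences of the three letters turns either side of the move into the other
      side with the blocks in reversed order.\<close>
    define rev3 :: "'m \<times> 'm \<times> 'm \<Rightarrow> 'm \<times> 'm \<times> 'm" where "rev3 = (\<lambda>(x, y, z). (z, y, x))"
    have rev3: "(x, y, z) = rev3 X \<longleftrightarrow> (z, y, x) = X" for x y z X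
      by (cases X) (auto simp: rev3_def)
    have rev3_closed: "rev3 X \<in> carrier N \<times> carrier N \<times> carrier N"
      if "X \<in> carrier N \<times> carrier N \<times> carrier N" for X
      using that by (auto simp: rev3_def)
    show ?thesis
    proof (rule that[of "\<lambda>p1 p2 p3. rev3 (G p3 p2 p1)" "\<lambda>p1 p2 p3. rev3 (F p3 p2 p1)"
          "\<lambda>p1 p2 p3 r1 r2 r3. Z p3 p2 p1 r3 r2 r1"])
      fix p1 p2 p3 q1 q2 q3 r1 r2 r3 assume "{p1, p2, p3, q1, q2, q3, r1, r2, r3} \<subseteq> carrier N"
      then have carr: "{p3, p2, p1, q3, q2, q1, r3, r2, r1} \<subseteq> carrier N" by auto
      show "sorted_wrt (compatible \<alpha> \<tau> \<beta> N pr)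
          [(A, p1, q1), (B, q1, r1), (A, p2, q2), (C, q2, r2), (B, p3, q3), (C, q3, r3)] \<longleftrightarrow>
        (q1, q2, q3) = rev3 (G p3 p2 p1) \<and> Z p3 p2 p1 r3 r2 r1"
        unfolding rev3 tri(2)[OF carr, symmetric] using False dist by (auto simp: comp)
      show "sorted_wrt (compatible \<alpha> \<tau> \<beta> N pr)
          [(B, p1, q1), (A, q1, r1), (C, p2, q2), (A, q2, r2), (C, p3, q3), (B, q3, r3)] \<longleftrightarrow>
        (q1, q2, q3) = rev3 (F p3 p2 p1) \<and> Z p3 p2 p1 r3 r2 r1"
        unfolding rev3 tri(1)[OF carr, symmetric] using False dist by (auto simp: comp)
    qed (use closed rev3_closed in auto)
  qed
qed

section \<open>Invariance under the homotopy moves\<close>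

lemma sorted_wrt_interleave:
  assumes "\<forall>e\<in>set (X @ Y @ Z @ T). \<forall>f\<in>set (a @ b @ c). P e f \<and> P f e"
  shows "sorted_wrt P (X @ a @ Y @ b @ Z @ c @ T) \<longleftrightarrow>
    sorted_wrt P (a @ b @ c) \<and> sorted_wrt P (X @ Y @ Z @ T)"
  using assms by (auto simp: sorted_wrt_append)

lemma edges_letter: "e \<in> set (edges p w vs) \<Longrightarrow> fst e \<in> set w"
  using edges_subset[of p UNIV vs w] by auto

text \<open>
  Letters of the blocks \<open>a\<close>, \<open>b\<close>, \<open>c\<close> do not occur elsewhere, so no equation links the blocks to the
  rest except through the labels at their ends. Two blocks or one block are the special cases with
  empty words.
\<close>

lemma labelling_split:
  assumes fresh: "set (x @ y @ z @ t) \<inter> set (a @ b @ c) = {}"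
    and len: "length vx = length x" "length va = length a" "length vy = length y" "length vb = length b"
      "length vz = length z" "length vc = length c" "length vt = length t"
  shows "labelling \<alpha> \<tau> \<beta> N \<lparr>letters = L, proj = pr, word = x @ a @ y @ b @ z @ c @ t\<rparr> p
      (vx @ va @ vy @ vb @ vz @ vc @ vt) \<longleftrightarrow>
    p \<in> carrier N \<and> set (vx @ va @ vy @ vb @ vz @ vc @ vt) \<subseteq> carrier N \<and>
    sorted_wrt (compatible \<alpha> \<tau> \<beta> N pr)
      (edges (endpoint p vx) a va @ edges (endpoint p (vx @ va @ vy)) b vb @
       edges (endpoint p (vx @ va @ vy @ vb @ vz)) c vc) \<and>
    sorted_wrt (compatible \<alpha> \<tau> \<beta> N pr)
      (edges p x vx @ edges (endpoint p (vx @ va)) y vy @ edges (endpoint p (vx @ va @ vy @ vb)) z vz @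
       edges (endpoint p (vx @ va @ vy @ vb @ vz @ vc)) t vt)"
proof -
  let ?X = "edges p x vx" and ?a = "edges (endpoint p vx) a va"
    and ?Y = "edges (endpoint p (vx @ va)) y vy" and ?b = "edges (endpoint p (vx @ va @ vy)) b vb"
    and ?Z = "edges (endpoint p (vx @ va @ vy @ vb)) z vz"
    and ?c = "edges (endpoint p (vx @ va @ vy @ vb @ vz)) c vc"
    and ?T = "edges (endpoint p (vx @ va @ vy @ vb @ vz @ vc)) t vt"
  have "fst e \<noteq> fst f" if "e \<in> set (?X @ ?Y @ ?Z @ ?T)" "f \<in> set (?a @ ?b @ ?c)" for e f
  proof -
    have "fst e \<in> set (x @ y @ z @ t)" "fst f \<in> set (a @ b @ c)"
      using that by (auto dest: edges_letter)
    with fresh show ?thesis by (metis IntI empty_iff)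
  qed
  moreover have "compatible \<alpha> \<tau> \<beta> N pr e f" if "fst e \<noteq> fst f" for e f
    using that by (auto simp: compatible_def split: prod.splits)
  ultimately have "sorted_wrt (compatible \<alpha> \<tau> \<beta> N pr) (?X @ ?a @ ?Y @ ?b @ ?Z @ ?c @ ?T) \<longleftrightarrow>
      sorted_wrt (compatible \<alpha> \<tau> \<beta> N pr) (?a @ ?b @ ?c) \<and>
      sorted_wrt (compatible \<alpha> \<tau> \<beta> N pr) (?X @ ?Y @ ?Z @ ?T)"
    by (intro sorted_wrt_interleave) metis
  then show ?thesis
    by (simp add: labelling_def len)
qed

lemma split_length:
  assumes "length vs = m + n"
  obtains us ws where "vs = us @ ws" "length us = m" "length ws = n"
  using assms that[of "take m vs" "drop m vs"] by simp

lemma is_nanoword_proj: "is_nanoword \<alpha> \<lparr>letters = L, proj = pr, word = w\<rparr> \<Longrightarrow> A \<in> L \<Longrightarrow> pr A \<in> \<alpha>"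
  by (auto simp: is_nanoword_def)

lemma labelling_length: "labelling \<alpha> \<tau> \<beta> N W p vs \<Longrightarrow> length vs = length (word W)"
  by (simp add: labelling_def)

text \<open>
  Labellings correspond by deleting the two labels that follow the letters of the kink. Going back,
  they are recovered from the label \<open>u\<close> that enters it: the inner one is a function of \<open>u\<close>, the
  leaving one is \<open>u\<close>.
\<close>

lemma K_isomorphic_move1:
  fixes x y :: "'l list"
  assumes \<tau>: "\<tau> \<in> \<alpha> \<rightarrow> \<alpha>" "\<And>a. a \<in> \<alpha> \<Longrightarrow> \<tau> (\<tau> a) = a"
    and W: "is_nanoword \<alpha> \<lparr>letters = L, proj = pr, word = x @ [A, A] @ y\<rparr>"
    and W': "is_nanoword \<alpha> \<lparr>letters = L - {A}, proj = pr, word = x @ y\<rparr>"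
    and A: "A \<in> L" and xy: "set x \<union> set y \<subseteq> L - {A}"
  shows "K_isomorphic \<alpha> \<tau> \<beta> \<lparr>letters = L, proj = pr, word = x @ [A, A] @ y\<rparr>
    \<lparr>letters = L - {A}, proj = pr, word = x @ y\<rparr>" (is "K_isomorphic \<alpha> \<tau> \<beta> ?W ?W'")
proof -
  have a: "pr A \<in> \<alpha>" by (rule is_nanoword_proj[OF W A])
  have \<tau>a: "\<tau> (pr A) \<in> \<alpha>" "\<tau> (\<tau> (pr A)) = pr A" using \<tau> a by auto
  define T :: "'a lam_vec set list \<Rightarrow> 'a lam_vec set list \<Rightarrow> bool" where
    "T vs vs' \<longleftrightarrow> (\<exists>vx q r vy. length vx = length x \<and> vs = vx @ [q, r] @ vy \<and> vs' = vx @ vy)" for vs vs'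
  have T: "T (vx @ [q, r] @ vy) vs' \<longleftrightarrow> vs' = vx @ vy"
      "T vs (vx @ vy) \<longleftrightarrow> (\<exists>q r. vs = vx @ [q, r] @ vy)" if "length vx = length x" for vs vs' vx q r vy
    using that by (auto simp: T_def)
  have key: "\<exists>f. \<forall>q r. labelling \<alpha> \<tau> \<beta> N ?W p (vx @ [q, r] @ vy) \<longleftrightarrow>
      labelling \<alpha> \<tau> \<beta> N ?W' p (vx @ vy) \<and> q = f \<and> r = endpoint p vx"
    if N: "left_module (Lam \<alpha> \<tau>) N" and len: "length vx = length x" "length vy = length y"
    for N :: "('a psi_gen gword set \<Rightarrow>\<^sub>0 int, 'a lam_vec set) module" and p vx vy
  proof -
    obtain f where f: "\<And>u. u \<in> carrier N \<Longrightarrow> f u \<in> carrier N"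
      "\<And>u q r. \<lbrakk>u \<in> carrier N; q \<in> carrier N; r \<in> carrier N\<rbrakk> \<Longrightarrow>
        sorted_wrt (compatible \<alpha> \<tau> \<beta> N pr) [(A, u, q), (A, q, r)] \<longleftrightarrow> q = f u \<and> r = u"
      using kink_compatible[OF N, where pr = pr and A = A and \<beta> = \<beta>, OF a \<tau>a] by blast
    have "labelling \<alpha> \<tau> \<beta> N ?W p (vx @ [q, r] @ vy) \<longleftrightarrow>
       labelling \<alpha> \<tau> \<beta> N ?W' p (vx @ vy) \<and> q = f (endpoint p vx) \<and> r = endpoint p vx" for q r
    proof -
      have "labelling \<alpha> \<tau> \<beta> N ?W p (vx @ [q, r] @ vy) \<longleftrightarrow> p \<in> carrier N \<and> set vx \<subseteq> carrier N \<and>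
          set vy \<subseteq> carrier N \<and> q \<in> carrier N \<and> r \<in> carrier N \<and>
          sorted_wrt (compatible \<alpha> \<tau> \<beta> N pr) [(A, endpoint p vx, q), (A, q, r)] \<and>
          sorted_wrt (compatible \<alpha> \<tau> \<beta> N pr) (edges p x vx @ edges r y vy)"
        using labelling_split[of x y "[]" "[]" "[A, A]" "[]" "[]" vx "[q, r]" vy "[]" "[]" "[]" "[]" \<alpha> \<tau> \<beta> N L pr p]
          xy len by auto
      also have "\<dots> \<longleftrightarrow> p \<in> carrier N \<and> set vx \<subseteq> carrier N \<and> set vy \<subseteq> carrier N \<and>
          q = f (endpoint p vx) \<and> r = endpoint p vx \<and>
          sorted_wrt (compatible \<alpha> \<tau> \<beta> N pr) (edges p x vx @ edges (endpoint p vx) y vy)"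
        using f(1)[of "endpoint p vx"] f(2)[of "endpoint p vx" q r] endpoint_closed[of p "carrier N" vx]
        by blast
      finally show ?thesis
        using len by (auto simp: labelling_def)
    qed
    then show ?thesis by blast
  qed
  show ?thesis
  proof (rule K_isomorphic_by_relabelling[OF W W', of _ _ T])
    fix N :: "('a psi_gen gword set \<Rightarrow>\<^sub>0 int, 'a lam_vec set) module" and p vs
    assume N: "left_module (Lam \<alpha> \<tau>) N" and vs: "labelling \<alpha> \<tau> \<beta> N ?W p vs"
    from labelling_length[OF vs] have "length vs = length x + Suc (Suc (length y))" by simp
    then obtain vx ws where ws: "vs = vx @ ws" "length vx = length x"
      "length ws = Suc (Suc (length y))" by (rule split_length)
    then obtain q r vy where vsx: "vs = vx @ [q, r] @ vy" "length vy = length y"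
      by (auto simp: length_Suc_conv)
    from key[OF N ws(2) vsx(2)] obtain f where f: "\<forall>q r. labelling \<alpha> \<tau> \<beta> N ?W p (vx @ [q, r] @ vy) \<longleftrightarrow>
       labelling \<alpha> \<tau> \<beta> N ?W' p (vx @ vy) \<and> q = f \<and> r = endpoint p vx" ..
    from vs[unfolded vsx(1) f[rule_format]] have "labelling \<alpha> \<tau> \<beta> N ?W' p (vx @ vy)" "r = endpoint p vx"
      by simp_all
    then show "\<exists>!vs'. labelling \<alpha> \<tau> \<beta> N ?W' p vs' \<and> endpoint p vs' = endpoint p vs \<and> T vs vs'"
      unfolding vsx(1) T(1)[OF ws(2)] by (intro ex1I[of _ "vx @ vy"]) auto
  next
    fix N :: "('a psi_gen gword set \<Rightarrow>\<^sub>0 int, 'a lam_vec set) module" and p vs'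
    assume N: "left_module (Lam \<alpha> \<tau>) N" and vs': "labelling \<alpha> \<tau> \<beta> N ?W' p vs'"
    from labelling_length[OF vs'] have "length vs' = length x + length y" by simp
    then obtain vx vy where vsx: "vs' = vx @ vy" "length vx = length x" "length vy = length y"
      by (rule split_length)
    from key[OF N vsx(2,3)] obtain f where f: "\<forall>q r. labelling \<alpha> \<tau> \<beta> N ?W p (vx @ [q, r] @ vy) \<longleftrightarrow>
       labelling \<alpha> \<tau> \<beta> N ?W' p (vx @ vy) \<and> q = f \<and> r = endpoint p vx" ..
    show "\<exists>!vs. labelling \<alpha> \<tau> \<beta> N ?W p vs \<and> endpoint p vs' = endpoint p vs \<and> T vs vs'"
      unfolding vsx(1) T(2)[OF vsx(2)] using vs' unfolding vsx(1)
      by (intro ex1I[of _ "vx @ [f, endpoint p vx] @ vy"]) (use f in auto)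
  next
    fix h vs vs' assume "T vs vs'"
    then obtain vx q r vy where b: "length vx = length x" "vs = vx @ [q, r] @ vy" "vs' = vx @ vy"
      unfolding T_def by (elim exE conjE)
    show "T (map h vs) (map h vs')"
      unfolding b(2,3) map_append list.map by (subst T(1)) (simp_all add: b(1))
  qed
qed

text \<open>
  Since the first block passes on the label \<open>u\<close> that enters it, deleting the labels that follow the
  four letters leaves a sequence on which the rest of the word still satisfies its equations, and the
  label \<open>v\<close> that enters the second block can be read off from that sequence. The two labels inside
  the blocks are functions of \<open>u\<close> and \<open>v\<close>.
\<close>

lemma K_isomorphic_move2:
  fixes x y z :: "'l list"
  assumes \<tau>: "\<And>a. a \<in> \<alpha> \<Longrightarrow> \<tau> (\<tau> a) = a" and \<beta>: "\<tau> ` \<beta> = \<beta>"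
    and W: "is_nanoword \<alpha> \<lparr>letters = L, proj = pr, word = x @ [A, B] @ y @ [B, A] @ z\<rparr>"
    and W': "is_nanoword \<alpha> \<lparr>letters = L - {A, B}, proj = pr, word = x @ y @ z\<rparr>"
    and AB: "A \<in> L" "B \<in> L" "A \<noteq> B" "pr A = \<tau> (pr B)" and xyz: "set x \<union> set y \<union> set z \<subseteq> L - {A, B}"
  shows "K_isomorphic \<alpha> \<tau> \<beta> \<lparr>letters = L, proj = pr, word = x @ [A, B] @ y @ [B, A] @ z\<rparr>
    \<lparr>letters = L - {A, B}, proj = pr, word = x @ y @ z\<rparr>" (is "K_isomorphic \<alpha> \<tau> \<beta> ?W ?W'")
proof -
  have a: "pr A \<in> \<alpha>" "pr B \<in> \<alpha>" by (rule is_nanoword_proj[OF W AB(1)], rule is_nanoword_proj[OF W AB(2)])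
  define T :: "'a lam_vec set list \<Rightarrow> 'a lam_vec set list \<Rightarrow> bool" where
    "T vs vs' \<longleftrightarrow> (\<exists>vx q r vy s t vz. length vx = length x \<and> length vy = length y \<and>
      vs = vx @ [q, r] @ vy @ [s, t] @ vz \<and> vs' = vx @ vy @ vz)" for vs vs'
  have T: "T (vx @ [q, r] @ vy @ [s, t] @ vz) vs' \<longleftrightarrow> vs' = vx @ vy @ vz"
      "T vs (vx @ vy @ vz) \<longleftrightarrow> (\<exists>q r s t. vs = vx @ [q, r] @ vy @ [s, t] @ vz)"
    if len: "length vx = length x" "length vy = length y" for vs vs' vx q r vy s t vz
  proof -
    have T: "T (vx @ [q, r] @ vy @ [s, t] @ vz) (vx @ vy @ vz)" for q r s t
      unfolding T_def by (intro exI conjI) (rule len refl)+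
    show "T (vx @ [q, r] @ vy @ [s, t] @ vz) vs' \<longleftrightarrow> vs' = vx @ vy @ vz"
    proof
      assume "T (vx @ [q, r] @ vy @ [s, t] @ vz) vs'"
      then show "vs' = vx @ vy @ vz" using len by (auto simp: T_def)
    qed (simp only: T)
    show "T vs (vx @ vy @ vz) \<longleftrightarrow> (\<exists>q r s t. vs = vx @ [q, r] @ vy @ [s, t] @ vz)"
    proof
      assume "T vs (vx @ vy @ vz)"
      then show "\<exists>q r s t. vs = vx @ [q, r] @ vy @ [s, t] @ vz" using len by (auto simp: T_def)
    qed (elim exE, simp only: T)
  qed
  have key: "\<exists>f g. \<forall>q r s t. labelling \<alpha> \<tau> \<beta> N ?W p (vx @ [q, r] @ vy @ [s, t] @ vz) \<longleftrightarrow>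
      labelling \<alpha> \<tau> \<beta> N ?W' p (vx @ vy @ vz) \<and> r = endpoint p vx \<and> t = endpoint p (vx @ vy) \<and>
      q = f \<and> s = g"
    if N: "left_module (Lam \<alpha> \<tau>) N"
      and len: "length vx = length x" "length vy = length y" "length vz = length z"
    for N :: "('a psi_gen gword set \<Rightarrow>\<^sub>0 int, 'a lam_vec set) module" and p vx vy vz
  proof -
    obtain f g where fg: "\<And>u v. u \<in> carrier N \<Longrightarrow> v \<in> carrier N \<Longrightarrow> f u v \<in> carrier N"
      "\<And>u v. u \<in> carrier N \<Longrightarrow> v \<in> carrier N \<Longrightarrow> g u v \<in> carrier N"
      "\<And>u v q r s t. \<lbrakk>u \<in> carrier N; v \<in> carrier N; q \<in> carrier N; r \<in> carrier N; s \<in> carrier N; t \<in> carrier N\<rbrakk> \<Longrightarrow>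
        sorted_wrt (compatible \<alpha> \<tau> \<beta> N pr) [(A, u, q), (B, q, r), (B, v, s), (A, s, t)] \<longleftrightarrow>
        r = u \<and> t = v \<and> q = f u v \<and> s = g u v"
      using cancelling_pair_compatible[where pr = pr, OF N \<beta> a \<tau>[OF a(2)] AB(3,4)] by blast
    have "labelling \<alpha> \<tau> \<beta> N ?W p (vx @ [q, r] @ vy @ [s, t] @ vz) \<longleftrightarrow>
       labelling \<alpha> \<tau> \<beta> N ?W' p (vx @ vy @ vz) \<and> r = endpoint p vx \<and> t = endpoint p (vx @ vy) \<and>
       q = f (endpoint p vx) (endpoint p (vx @ vy)) \<and> s = g (endpoint p vx) (endpoint p (vx @ vy))" for q r s t
    proof -
      let ?u = "endpoint p vx" and ?v = "\<lambda>r. endpoint r vy"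
      have "labelling \<alpha> \<tau> \<beta> N ?W p (vx @ [q, r] @ vy @ [s, t] @ vz) \<longleftrightarrow> p \<in> carrier N \<and> set vx \<subseteq> carrier N \<and>
          set vy \<subseteq> carrier N \<and> set vz \<subseteq> carrier N \<and> q \<in> carrier N \<and> r \<in> carrier N \<and> s \<in> carrier N \<and> t \<in> carrier N \<and>
          sorted_wrt (compatible \<alpha> \<tau> \<beta> N pr) [(A, ?u, q), (B, q, r), (B, ?v r, s), (A, s, t)] \<and>
          sorted_wrt (compatible \<alpha> \<tau> \<beta> N pr) (edges p x vx @ edges r y vy @ edges t z vz)"
        using labelling_split[of x y z "[]" "[A, B]" "[B, A]" "[]" vx "[q, r]" vy "[s, t]" vz "[]" "[]" \<alpha> \<tau> \<beta> N L pr p]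
          xyz len by auto
      also have "\<dots> \<longleftrightarrow> p \<in> carrier N \<and> set vx \<subseteq> carrier N \<and> set vy \<subseteq> carrier N \<and> set vz \<subseteq> carrier N \<and>
          r = ?u \<and> t = ?v ?u \<and> q = f ?u (?v ?u) \<and> s = g ?u (?v ?u) \<and>
          sorted_wrt (compatible \<alpha> \<tau> \<beta> N pr) (edges p x vx @ edges ?u y vy @ edges (?v ?u) z vz)"
        using fg(1,2)[of ?u "?v ?u"] fg(3)[of ?u "?v r" q r s t]
          endpoint_closed[of p "carrier N" vx] endpoint_closed[of r "carrier N" vy]
        by blast
      finally show ?thesis
        using len by (auto simp: labelling_def)
    qed
    then show ?thesis by blast
  qed
  show ?thesis
  proof (rule K_isomorphic_by_relabelling[OF W W', of _ _ T])
    fix N :: "('a psi_gen gword set \<Rightarrow>\<^sub>0 int, 'a lam_vec set) module" and p vs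
    assume N: "left_module (Lam \<alpha> \<tau>) N" and vs: "labelling \<alpha> \<tau> \<beta> N ?W p vs"
    from labelling_length[OF vs]
    have "length vs = length x + Suc (Suc (length y + Suc (Suc (length z))))" by simp
    then obtain vx ws where ws: "vs = vx @ ws" "length vx = length x"
      "length ws = Suc (Suc (length y + Suc (Suc (length z))))" by (rule split_length)
    then obtain q r us where us: "ws = [q, r] @ us" "length us = length y + Suc (Suc (length z))"
      by (auto simp: length_Suc_conv)
    from us(2) obtain vy us' where us': "us = vy @ us'" "length vy = length y"
      "length us' = Suc (Suc (length z))" by (rule split_length)
    then obtain s t vz where vz: "us' = [s, t] @ vz" "length vz = length z"
      by (auto simp: length_Suc_conv)
    have vsx: "vs = vx @ [q, r] @ vy @ [s, t] @ vz" by (simp add: ws us us' vz)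
    from key[OF N ws(2) us'(2) vz(2), of p] obtain f g where fg: "\<forall>q r s t. labelling \<alpha> \<tau> \<beta> N ?W p (vx @ [q, r] @ vy @ [s, t] @ vz) \<longleftrightarrow>
      labelling \<alpha> \<tau> \<beta> N ?W' p (vx @ vy @ vz) \<and> r = endpoint p vx \<and> t = endpoint p (vx @ vy) \<and>
      q = f \<and> s = g"
      by (elim exE)
    from vs[unfolded vsx fg[rule_format]] have "labelling \<alpha> \<tau> \<beta> N ?W' p (vx @ vy @ vz)" "r = endpoint p vx"
      "t = endpoint p (vx @ vy)"
      by simp_all
    then show "\<exists>!vs'. labelling \<alpha> \<tau> \<beta> N ?W' p vs' \<and> endpoint p vs' = endpoint p vs \<and> T vs vs'"
      unfolding vsx(1) T(1)[OF ws(2) us'(2)] by (intro ex1I[of _ "vx @ vy @ vz"]) auto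
  next
    fix N :: "('a psi_gen gword set \<Rightarrow>\<^sub>0 int, 'a lam_vec set) module" and p vs'
    assume N: "left_module (Lam \<alpha> \<tau>) N" and vs': "labelling \<alpha> \<tau> \<beta> N ?W' p vs'"
    from labelling_length[OF vs'] have "length vs' = length x + (length y + length z)" by simp
    then obtain vx us where us: "vs' = vx @ us" "length vx = length x" "length us = length y + length z"
      by (rule split_length)
    from us(3) obtain vy vz where vyz: "us = vy @ vz" "length vy = length y" "length vz = length z"
      by (rule split_length)
    have vsx: "vs' = vx @ vy @ vz" by (simp add: us vyz)
    from key[OF N us(2) vyz(2,3), of p] obtain f g where fg: "\<forall>q r s t. labelling \<alpha> \<tau> \<beta> N ?W p (vx @ [q, r] @ vy @ [s, t] @ vz) \<longleftrightarrow>
      labelling \<alpha> \<tau> \<beta> N ?W' p (vx @ vy @ vz) \<and> r = endpoint p vx \<and> t = endpoint p (vx @ vy) \<and>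
      q = f \<and> s = g"
      by (elim exE)
    show "\<exists>!vs. labelling \<alpha> \<tau> \<beta> N ?W p vs \<and> endpoint p vs' = endpoint p vs \<and> T vs vs'"
      unfolding vsx(1) T(2)[OF us(2) vyz(2)] using vs' unfolding vsx(1)
      by (intro ex1I[of _ "vx @ [f, endpoint p vx] @ vy @ [g, endpoint p (vx @ vy)] @ vz"]) (use fg in auto)
  next
    fix h vs vs' assume "T vs vs'"
    then obtain vx q r vy s t vz where b: "length vx = length x" "length vy = length y"
      "vs = vx @ [q, r] @ vy @ [s, t] @ vz" "vs' = vx @ vy @ vz"
      unfolding T_def by (elim exE conjE)
    show "T (map h vs) (map h vs')"
      unfolding b(3,4) map_append list.map by (subst T(1)) (simp_all add: b(1,2))
  qed
qed

text \<open>
  Corresponding labellings agree except for the labels inside the three blocks. In \<open>fill\<close> all labels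
  but these are fixed: for given outer labels, either both words have exactly one labelling or none
  of them has one.
\<close>

lemma K_isomorphic_move3:
  fixes x y z t :: "'l list"
  assumes W: "is_nanoword \<alpha> \<lparr>letters = L, proj = pr, word = x @ [A, B] @ y @ [A, C] @ z @ [B, C] @ t\<rparr>"
    and W': "is_nanoword \<alpha> \<lparr>letters = L, proj = pr, word = x @ [B, A] @ y @ [C, A] @ z @ [C, B] @ t\<rparr>"
    and A: "A \<in> L" and dist: "distinct [A, B, C]" and pr: "pr A = pr B" "pr B = pr C"
    and xyzt: "set x \<union> set y \<union> set z \<union> set t \<subseteq> L - {A, B, C}"
  shows "K_isomorphic \<alpha> \<tau> \<beta>
    \<lparr>letters = L, proj = pr, word = x @ [A, B] @ y @ [A, C] @ z @ [B, C] @ t\<rparr>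
    \<lparr>letters = L, proj = pr, word = x @ [B, A] @ y @ [C, A] @ z @ [C, B] @ t\<rparr>"
    (is "K_isomorphic \<alpha> \<tau> \<beta> ?W ?W'")
proof -
  have a: "pr A \<in> \<alpha>" by (rule is_nanoword_proj[OF W A])
  define fill :: "'a lam_vec set list \<Rightarrow> 'a lam_vec set \<Rightarrow> 'a lam_vec set list \<Rightarrow> 'a lam_vec set \<Rightarrow>
      'a lam_vec set list \<Rightarrow> 'a lam_vec set \<Rightarrow> 'a lam_vec set list \<Rightarrow>
      'a lam_vec set \<times> 'a lam_vec set \<times> 'a lam_vec set \<Rightarrow> 'a lam_vec set list" where
    "fill vx r1 vy r2 vz r3 vt = (\<lambda>(q1, q2, q3). vx @ [q1, r1] @ vy @ [q2, r2] @ vz @ [q3, r3] @ vt)"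
    for vx r1 vy r2 vz r3 vt
  define T where "T vs vs' \<longleftrightarrow> (\<exists>vx r1 vy r2 vz r3 vt q q'. length vx = length x \<and> length vy = length y \<and>
      length vz = length z \<and> vs = fill vx r1 vy r2 vz r3 vt q \<and> vs' = fill vx r1 vy r2 vz r3 vt q')"
    for vs vs'
  have fill_eq: "fill vx r1 vy r2 vz r3 vt q = fill vx' r1' vy' r2' vz' r3' vt' q' \<longleftrightarrow>
      vx = vx' \<and> r1 = r1' \<and> vy = vy' \<and> r2 = r2' \<and> vz = vz' \<and> r3 = r3' \<and> vt = vt' \<and> q = q'"
    if "length vx = length x" "length vy = length y" "length vz = length z"
      "length vx' = length x" "length vy' = length y" "length vz' = length z"
    for vx r1 vy r2 vz r3 vt q vx' r1' vy' r2' vz' r3' vt' q'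
    using that by (cases q; cases q') (auto simp: fill_def)
  have T: "T (fill vx r1 vy r2 vz r3 vt q) vs' \<longleftrightarrow> (\<exists>q'. vs' = fill vx r1 vy r2 vz r3 vt q')"
      "T vs (fill vx r1 vy r2 vz r3 vt q) \<longleftrightarrow> (\<exists>q'. vs = fill vx r1 vy r2 vz r3 vt q')"
    if len: "length vx = length x" "length vy = length y" "length vz = length z"
    for vx r1 vy r2 vz r3 vt q vs vs'
  proof -
    have T: "T (fill vx r1 vy r2 vz r3 vt q) (fill vx r1 vy r2 vz r3 vt q')" for q q'
      unfolding T_def by (intro exI conjI) (rule len refl)+
    show "T (fill vx r1 vy r2 vz r3 vt q) vs' \<longleftrightarrow> (\<exists>q'. vs' = fill vx r1 vy r2 vz r3 vt q')"
    proof
      assume "T (fill vx r1 vy r2 vz r3 vt q) vs'"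
      then show "\<exists>q'. vs' = fill vx r1 vy r2 vz r3 vt q'"
        unfolding T_def using len by (elim exE conjE) (simp add: fill_eq del: split_paired_Ex)
    qed (elim exE, simp only: T)
    show "T vs (fill vx r1 vy r2 vz r3 vt q) \<longleftrightarrow> (\<exists>q'. vs = fill vx r1 vy r2 vz r3 vt q')"
    proof
      assume "T vs (fill vx r1 vy r2 vz r3 vt q)"
      then show "\<exists>q'. vs = fill vx r1 vy r2 vz r3 vt q'"
        unfolding T_def using len by (elim exE conjE) (simp add: fill_eq del: split_paired_Ex)
    qed (elim exE, simp only: T)
  qed
  have fill_end: "endpoint p (fill vx r1 vy r2 vz r3 vt q) = endpoint r3 vt" for p vx r1 vy r2 vz r3 vt q
    by (cases q) (simp add: fill_def)
  have blocks: "\<exists>vx r1 vy r2 vz r3 vt q. length vx = length x \<and> length vy = length y \<and> length vz = length z \<and>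
      length vt = length t \<and> vs = fill vx r1 vy r2 vz r3 vt q"
    if "length vs = length x + Suc (Suc (length y + Suc (Suc (length z + Suc (Suc (length t))))))" for vs
  proof -
    from that obtain vx us where 1: "vs = vx @ us" "length vx = length x"
      "length us = Suc (Suc (length y + Suc (Suc (length z + Suc (Suc (length t))))))"
      by (rule split_length)
    then obtain q1 r1 us' where 2: "us = [q1, r1] @ us'"
      "length us' = length y + Suc (Suc (length z + Suc (Suc (length t))))"
      by (auto simp: length_Suc_conv)
    from 2(2) obtain vy us where 3: "us' = vy @ us" "length vy = length y"
      "length us = Suc (Suc (length z + Suc (Suc (length t))))"
      by (rule split_length)
    then obtain q2 r2 us' where 4: "us = [q2, r2] @ us'" "length us' = length z + Suc (Suc (length t))"
      by (auto simp: length_Suc_conv)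
    from 4(2) obtain vz us where 5: "us' = vz @ us" "length vz = length z" "length us = Suc (Suc (length t))"
      by (rule split_length)
    then obtain q3 r3 vt where 6: "us = [q3, r3] @ vt" "length vt = length t"
      by (auto simp: length_Suc_conv)
    have "vs = fill vx r1 vy r2 vz r3 vt (q1, q2, q3)"
      by (simp add: fill_def 1 2 3 4 5 6)
    with 1(2) 3(2) 5(2) 6(2) show ?thesis by blast
  qed
  have key: "\<exists>S f g. \<forall>q. (labelling \<alpha> \<tau> \<beta> N ?W p (fill vx r1 vy r2 vz r3 vt q) \<longleftrightarrow> S \<and> q = f) \<and>
      (labelling \<alpha> \<tau> \<beta> N ?W' p (fill vx r1 vy r2 vz r3 vt q) \<longleftrightarrow> S \<and> q = g)"
    if N: "left_module (Lam \<alpha> \<tau>) N"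
      and len: "length vx = length x" "length vy = length y" "length vz = length z" "length vt = length t"
    for N :: "('a psi_gen gword set \<Rightarrow>\<^sub>0 int, 'a lam_vec set) module" and p vx r1 vy r2 vz r3 vt
  proof -
    obtain F G :: "'a lam_vec set \<Rightarrow> 'a lam_vec set \<Rightarrow> 'a lam_vec set \<Rightarrow>
        'a lam_vec set \<times> 'a lam_vec set \<times> 'a lam_vec set" and Z
      where F: "\<And>p1 p2 p3. \<lbrakk>p1 \<in> carrier N; p2 \<in> carrier N; p3 \<in> carrier N\<rbrakk> \<Longrightarrow>
          F p1 p2 p3 \<in> carrier N \<times> carrier N \<times> carrier N"
        and G: "\<And>p1 p2 p3. \<lbrakk>p1 \<in> carrier N; p2 \<in> carrier N; p3 \<in> carrier N\<rbrakk> \<Longrightarrow>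
          G p1 p2 p3 \<in> carrier N \<times> carrier N \<times> carrier N"
        and old: "\<And>p1 p2 p3 q1 q2 q3 r1 r2 r3. {p1, p2, p3, q1, q2, q3, r1, r2, r3} \<subseteq> carrier N \<Longrightarrow>
          sorted_wrt (compatible \<alpha> \<tau> \<beta> N pr)
            [(A, p1, q1), (B, q1, r1), (A, p2, q2), (C, q2, r2), (B, p3, q3), (C, q3, r3)] \<longleftrightarrow>
          (q1, q2, q3) = F p1 p2 p3 \<and> Z p1 p2 p3 r1 r2 r3"
        and new: "\<And>p1 p2 p3 q1 q2 q3 r1 r2 r3. {p1, p2, p3, q1, q2, q3, r1, r2, r3} \<subseteq> carrier N \<Longrightarrow>
          sorted_wrt (compatible \<alpha> \<tau> \<beta> N pr)
            [(B, p1, q1), (A, q1, r1), (C, p2, q2), (A, q2, r2), (C, p3, q3), (B, q3, r3)] \<longleftrightarrow>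
          (q1, q2, q3) = G p1 p2 p3 \<and> Z p1 p2 p3 r1 r2 r3"
      using triangle_compatible[where pr = pr, OF N a pr dist, of \<beta>] by blast
    let ?p1 = "endpoint p vx" and ?p2 = "endpoint r1 vy" and ?p3 = "endpoint r2 vz"
    define S0 where "S0 \<longleftrightarrow> p \<in> carrier N \<and> set vx \<union> set vy \<union> set vz \<union> set vt \<subseteq> carrier N \<and>
        {r1, r2, r3} \<subseteq> carrier N \<and>
        sorted_wrt (compatible \<alpha> \<tau> \<beta> N pr)
          (edges p x vx @ edges r1 y vy @ edges r2 z vz @ edges r3 t vt)"
    have ep: "{?p1, ?p2, ?p3, r1, r2, r3} \<subseteq> carrier N" if S0
      using that by (simp add: S0_def endpoint_closed)
    have split: "labelling \<alpha> \<tau> \<beta> N \<lparr>letters = L, proj = pr, word = x @ [A1, B1] @ y @ [A2, B2] @ z @ [A3, B3] @ t\<rparr>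
          p (fill vx r1 vy r2 vz r3 vt (q1, q2, q3)) \<longleftrightarrow>
        S0 \<and> {q1, q2, q3} \<subseteq> carrier N \<and> sorted_wrt (compatible \<alpha> \<tau> \<beta> N pr)
          [(A1, ?p1, q1), (B1, q1, r1), (A2, ?p2, q2), (B2, q2, r2), (A3, ?p3, q3), (B3, q3, r3)]"
      if "{A1, B1, A2, B2, A3, B3} \<subseteq> {A, B, C}" for A1 B1 A2 B2 A3 B3 q1 q2 q3
    proof -
      have fresh: "set (x @ y @ z @ t) \<inter> set ([A1, B1] @ [A2, B2] @ [A3, B3]) = {}"
      proof -
        have "set ([A1, B1] @ [A2, B2] @ [A3, B3]) \<subseteq> {A, B, C}"
          using that by simp
        moreover have "set (x @ y @ z @ t) \<subseteq> L - {A, B, C}"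
          using xyzt by simp
        ultimately show ?thesis by blast
      qed
      have len': "length [q, r] = length [A, B]" for q r :: "'a lam_vec set" and A B :: 'l
        by simp
      show ?thesis
        unfolding fill_def prod.case
        unfolding labelling_split[OF fresh len(1) len' len(2) len' len(3) len' len(4)]
        by (simp add: S0_def del: sorted_wrt.simps) blast
    qed
    have "labelling \<alpha> \<tau> \<beta> N ?W p (fill vx r1 vy r2 vz r3 vt (q1, q2, q3)) \<longleftrightarrow>
        (S0 \<and> Z ?p1 ?p2 ?p3 r1 r2 r3) \<and> (q1, q2, q3) = F ?p1 ?p2 ?p3" for q1 q2 q3
    proof (cases "S0 \<and> {q1, q2, q3} \<subseteq> carrier N")
      case True
      then have "{?p1, ?p2, ?p3, q1, q2, q3, r1, r2, r3} \<subseteq> carrier N" using ep by simp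
      from old[OF this] True show ?thesis by (subst split) (auto simp del: sorted_wrt.simps)
    next
      case False
      moreover have "{q1, q2, q3} \<subseteq> carrier N" if "S0" "(q1, q2, q3) = F ?p1 ?p2 ?p3"
        using F[of ?p1 ?p2 ?p3] ep[OF that(1)] by (simp flip: that(2))
      ultimately show ?thesis by (subst split) (auto simp del: sorted_wrt.simps)
    qed
    moreover have "labelling \<alpha> \<tau> \<beta> N ?W' p (fill vx r1 vy r2 vz r3 vt (q1, q2, q3)) \<longleftrightarrow>
        (S0 \<and> Z ?p1 ?p2 ?p3 r1 r2 r3) \<and> (q1, q2, q3) = G ?p1 ?p2 ?p3" for q1 q2 q3
    proof (cases "S0 \<and> {q1, q2, q3} \<subseteq> carrier N")
      case True
      then have "{?p1, ?p2, ?p3, q1, q2, q3, r1, r2, r3} \<subseteq> carrier N" using ep by simp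
      from new[OF this] True show ?thesis by (subst split) (auto simp del: sorted_wrt.simps)
    next
      case False
      moreover have "{q1, q2, q3} \<subseteq> carrier N" if "S0" "(q1, q2, q3) = G ?p1 ?p2 ?p3"
        using G[of ?p1 ?p2 ?p3] ep[OF that(1)] by (simp flip: that(2))
      ultimately show ?thesis by (subst split) (auto simp del: sorted_wrt.simps)
    qed
    ultimately show ?thesis
      by (intro exI[of _ "S0 \<and> Z ?p1 ?p2 ?p3 r1 r2 r3"] exI[of _ "F ?p1 ?p2 ?p3"]
          exI[of _ "G ?p1 ?p2 ?p3"]) (simp add: split_paired_all)
  qed
  show ?thesis
  proof (rule K_isomorphic_by_relabelling[OF W W', of _ _ T])
    fix N :: "('a psi_gen gword set \<Rightarrow>\<^sub>0 int, 'a lam_vec set) module" and p vs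
    assume N: "left_module (Lam \<alpha> \<tau>) N" and vs: "labelling \<alpha> \<tau> \<beta> N ?W p vs"
    obtain vx r1 vy r2 vz r3 vt q where b: "length vx = length x" "length vy = length y"
      "length vz = length z" "length vt = length t" "vs = fill vx r1 vy r2 vz r3 vt q"
      using blocks[of vs] labelling_length[OF vs] by auto
    from key[OF N b(1-4), of p r1 r2 r3] obtain S f g where
      lab: "\<forall>q. (labelling \<alpha> \<tau> \<beta> N ?W p (fill vx r1 vy r2 vz r3 vt q) \<longleftrightarrow> S \<and> q = f) \<and>
        (labelling \<alpha> \<tau> \<beta> N ?W' p (fill vx r1 vy r2 vz r3 vt q) \<longleftrightarrow> S \<and> q = g)"
      by (elim exE)
    note L = lab[rule_format, THEN conjunct1] and L' = lab[rule_format, THEN conjunct2]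
    have S using vs unfolding b(5) L by (rule conjunct1)
    show "\<exists>!vs'. labelling \<alpha> \<tau> \<beta> N ?W' p vs' \<and> endpoint p vs' = endpoint p vs \<and> T vs vs'"
      unfolding b(5) T(1)[OF b(1-3)]
    proof (rule ex1I[of _ "fill vx r1 vy r2 vz r3 vt g"])
      show "labelling \<alpha> \<tau> \<beta> N ?W' p (fill vx r1 vy r2 vz r3 vt g) \<and> endpoint p (fill vx r1 vy r2 vz r3 vt g) = endpoint p (fill vx r1 vy r2 vz r3 vt q) \<and>
          (\<exists>q'. fill vx r1 vy r2 vz r3 vt g = fill vx r1 vy r2 vz r3 vt q')"
        using \<open>S\<close> by (intro conjI exI[of _ g]) (simp_all only: L' fill_end simp_thms)
    next
      fix v assume v: "labelling \<alpha> \<tau> \<beta> N ?W' p v \<and> endpoint p v = endpoint p (fill vx r1 vy r2 vz r3 vt q) \<and> (\<exists>q'. v = fill vx r1 vy r2 vz r3 vt q')"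
      then obtain q' where "v = fill vx r1 vy r2 vz r3 vt q'" by (elim conjE exE)
      with v show "v = fill vx r1 vy r2 vz r3 vt g" by (simp only: L')
    qed
  next
    fix N :: "('a psi_gen gword set \<Rightarrow>\<^sub>0 int, 'a lam_vec set) module" and p vs'
    assume N: "left_module (Lam \<alpha> \<tau>) N" and vs': "labelling \<alpha> \<tau> \<beta> N ?W' p vs'"
    obtain vx r1 vy r2 vz r3 vt q where b: "length vx = length x" "length vy = length y"
      "length vz = length z" "length vt = length t" "vs' = fill vx r1 vy r2 vz r3 vt q"
      using blocks[of vs'] labelling_length[OF vs'] by auto
    from key[OF N b(1-4), of p r1 r2 r3] obtain S f g where
      lab: "\<forall>q. (labelling \<alpha> \<tau> \<beta> N ?W p (fill vx r1 vy r2 vz r3 vt q) \<longleftrightarrow> S \<and> q = f) \<and>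
        (labelling \<alpha> \<tau> \<beta> N ?W' p (fill vx r1 vy r2 vz r3 vt q) \<longleftrightarrow> S \<and> q = g)"
      by (elim exE)
    note L = lab[rule_format, THEN conjunct1] and L' = lab[rule_format, THEN conjunct2]
    have S using vs' unfolding b(5) L' by (rule conjunct1)
    show "\<exists>!vs. labelling \<alpha> \<tau> \<beta> N ?W p vs \<and> endpoint p vs' = endpoint p vs \<and> T vs vs'"
      unfolding b(5) T(2)[OF b(1-3)]
    proof (rule ex1I[of _ "fill vx r1 vy r2 vz r3 vt f"])
      show "labelling \<alpha> \<tau> \<beta> N ?W p (fill vx r1 vy r2 vz r3 vt f) \<and> endpoint p (fill vx r1 vy r2 vz r3 vt q) = endpoint p (fill vx r1 vy r2 vz r3 vt f) \<and>
          (\<exists>q'. fill vx r1 vy r2 vz r3 vt f = fill vx r1 vy r2 vz r3 vt q')"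
        using \<open>S\<close> by (intro conjI exI[of _ f]) (simp_all only: L fill_end simp_thms)
    next
      fix v assume v: "labelling \<alpha> \<tau> \<beta> N ?W p v \<and> endpoint p (fill vx r1 vy r2 vz r3 vt q) = endpoint p v \<and> (\<exists>q'. v = fill vx r1 vy r2 vz r3 vt q')"
      then obtain q' where "v = fill vx r1 vy r2 vz r3 vt q'" by (elim conjE exE)
      with v show "v = fill vx r1 vy r2 vz r3 vt f" by (simp only: L)
    qed
  next
    fix h vs vs' assume "T vs vs'"
    then obtain vx r1 vy r2 vz r3 vt q q' where b: "length vx = length x" "length vy = length y"
      "length vz = length z" "vs = fill vx r1 vy r2 vz r3 vt q" "vs' = fill vx r1 vy r2 vz r3 vt q'"
      unfolding T_def by (elim exE conjE)
    have map_fill: "map h (fill vx r1 vy r2 vz r3 vt q) =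
        fill (map h vx) (h r1) (map h vy) (h r2) (map h vz) (h r3) (map h vt) (map_prod h (map_prod h h) q)" for q
      by (cases q) (simp add: fill_def)
    show "T (map h vs) (map h vs')"
      unfolding b(4,5) map_fill by (subst T(1)) (use b(1-3) in \<open>auto simp del: split_paired_Ex\<close>)
  qed
qed

lemma sorted_wrt_cong_set:
  assumes "\<And>x y. x \<in> set xs \<Longrightarrow> y \<in> set xs \<Longrightarrow> P x y \<longleftrightarrow> Q x y"
  shows "sorted_wrt P xs \<longleftrightarrow> sorted_wrt Q xs"
  using assms by (auto simp: sorted_wrt_iff_nth_less)

lemma K_isomorphic_iso:
  fixes W W' :: "('l, 'a) nanoword"
  assumes W: "is_nanoword \<alpha> W" and W': "is_nanoword \<alpha> W'" and iso: "nanoword_isomorphic W W'"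
  shows "K_isomorphic \<alpha> \<tau> \<beta> W W'"
proof -
  obtain f where f: "inj_on f (letters W)" "\<And>A. A \<in> letters W \<Longrightarrow> proj W' (f A) = proj W A"
    "word W' = map f (word W)"
    using iso by (auto simp: nanoword_isomorphic_def bij_betw_def)
  have "labelling \<alpha> \<tau> \<beta> N W' p vs \<longleftrightarrow> labelling \<alpha> \<tau> \<beta> N W p vs"
    for N :: "('a psi_gen gword set \<Rightarrow>\<^sub>0 int, 'a lam_vec set) module" and p vs
  proof -
    let ?E = "edges p (word W) vs"
    have "fst e \<in> letters W" if "e \<in> set ?E" for e
      using edges_letter[OF that] W by (auto simp: is_nanoword_def)
    then have "compatible \<alpha> \<tau> \<beta> N (proj W') (case d of (A, q, r) \<Rightarrow> (f A, q, r)) (case e of (A, q, r) \<Rightarrow> (f A, q, r))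
        \<longleftrightarrow> compatible \<alpha> \<tau> \<beta> N (proj W) d e" if "d \<in> set ?E" "e \<in> set ?E" for d e
      using that f(1,2) by (cases d; cases e) (fastforce simp: compatible_def inj_on_eq_iff)
    then have "sorted_wrt (compatible \<alpha> \<tau> \<beta> N (proj W')) (map (\<lambda>(A, q, r). (f A, q, r)) ?E) \<longleftrightarrow>
        sorted_wrt (compatible \<alpha> \<tau> \<beta> N (proj W)) ?E"
      unfolding sorted_wrt_map by (rule sorted_wrt_cong_set)
    then show ?thesis
      using edges_map[of "\<lambda>x. x" p f "word W" vs] by (simp add: labelling_def f(3))
  qed
  then show ?thesis
    by (intro K_isomorphic_by_relabelling[OF W W', of _ _ "(=)"]) auto
qed

lemma is_nanoword_subalphabet:
  assumes "is_nanoword \<alpha> \<lparr>letters = L, proj = pr, word = w\<rparr>" "L' \<subseteq> L" "set w' \<subseteq> L'"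
    and "\<And>C. C \<in> L' \<Longrightarrow> count_list w' C = count_list w C"
  shows "is_nanoword \<alpha> \<lparr>letters = L', proj = pr, word = w'\<rparr>"
  using assms by (auto simp: is_nanoword_def intro: finite_subset)

lemma homotopy_step_K_isomorphic:
  assumes \<tau>: "\<tau> \<in> \<alpha> \<rightarrow> \<alpha>" "\<And>a. a \<in> \<alpha> \<Longrightarrow> \<tau> (\<tau> a) = a" and \<beta>: "\<tau> ` \<beta> = \<beta>"
    and step: "homotopy_step \<alpha> \<tau> W W'"
  shows "K_isomorphic \<alpha> \<tau> \<beta> W W'"
  using step
proof cases
  case iso
  then show ?thesis by (rule K_isomorphic_iso)
next
  case (move1 L p x A y)
  have W': "is_nanoword \<alpha> \<lparr>letters = L - {A}, proj = p, word = x @ y\<rparr>"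
    by (rule is_nanoword_subalphabet[OF move1(3)]) (use move1(4-) in auto)
  show ?thesis
    unfolding move1(1,2) by (intro K_isomorphic_move1 \<tau> move1(3-5) W')
next
  case (move2 L p x A B y z)
  have W': "is_nanoword \<alpha> \<lparr>letters = L - {A, B}, proj = p, word = x @ y @ z\<rparr>"
    by (rule is_nanoword_subalphabet[OF move2(3)]) (use move2(4-) in auto)
  show ?thesis
    unfolding move2(1,2) by (intro K_isomorphic_move2 \<tau>(2) \<beta> move2(3-8) W')
next
  case (move3 L p x A B y C z t)
  have W': "is_nanoword \<alpha> \<lparr>letters = L, proj = p, word = x @ [B, A] @ y @ [C, A] @ z @ [C, B] @ t\<rparr>"
    by (rule is_nanoword_subalphabet[OF move3(3)]) (use move3(4-) in auto)
  show ?thesis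
    unfolding move3(1,2) by (intro K_isomorphic_move3 move3(3-10) W')
qed

theorem theorem7p2:
  fixes \<alpha> \<beta> :: "'a set" and \<tau> :: "'a \<Rightarrow> 'a" and w w' :: "('l, 'a) nanoword"
  assumes "\<tau> \<in> \<alpha> \<rightarrow> \<alpha>" and "\<And>a. a \<in> \<alpha> \<Longrightarrow> \<tau> (\<tau> a) = a"
    and "\<beta> \<subseteq> \<alpha>" and "\<tau> ` \<beta> = \<beta>"
    and "is_nanoword \<alpha> w" and "is_nanoword \<alpha> w'"
    and "homotopic \<alpha> \<tau> w w'"
  shows "\<exists>h \<in> module_iso (Lam \<alpha> \<tau>) (K_module \<alpha> \<tau> \<beta> w) (K_module \<alpha> \<tau> \<beta> w').
           h (K_input \<alpha> \<tau> \<beta> w) = K_input \<alpha> \<tau> \<beta> w' \<and>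
           h (K_output \<alpha> \<tau> \<beta> w) = K_output \<alpha> \<tau> \<beta> w'"
proof -
  have "K_isomorphic \<alpha> \<tau> \<beta> w w'"
    using assms(7) unfolding homotopic_def
  proof (induction rule: equivclp_induct)
    case base
    show ?case by (rule K_isomorphic_refl)
  next
    case (step W W')
    then have "K_isomorphic \<alpha> \<tau> \<beta> W W'"
      using homotopy_step_K_isomorphic[of \<tau> \<alpha> \<beta>, OF assms(1,2,4)] K_isomorphic_sym by blast
    with step.IH show ?case by (rule K_isomorphic_trans)
  qed
  then obtain h k where "h \<in> lin_hom (Lam \<alpha> \<tau>) (K_module \<alpha> \<tau> \<beta> w) (K_module \<alpha> \<tau> \<beta> w')"
    "k \<in> lin_hom (Lam \<alpha> \<tau>) (K_module \<alpha> \<tau> \<beta> w') (K_module \<alpha> \<tau> \<beta> w)"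
    "\<forall>x \<in> carrier (K_module \<alpha> \<tau> \<beta> w). k (h x) = x" "\<forall>y \<in> carrier (K_module \<alpha> \<tau> \<beta> w'). h (k y) = y"
    and io: "h (K_input \<alpha> \<tau> \<beta> w) = K_input \<alpha> \<tau> \<beta> w'" "h (K_output \<alpha> \<tau> \<beta> w) = K_output \<alpha> \<tau> \<beta> w'"
    unfolding K_isomorphic_def by (elim bexE conjE)
  then have "h \<in> module_iso (Lam \<alpha> \<tau>) (K_module \<alpha> \<tau> \<beta> w) (K_module \<alpha> \<tau> \<beta> w')"
    by (intro module_iso_of_inverse_homs) auto
  with io show ?thesis by blast
qed

end
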